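(* Let $X=(X_1,X_2)$ be a bivariate random closed set in $\mathbb{R}^d$ and $\Gamma=(\Gamma_1,\Gamma_2)$ a bivariate random field on $\mathbb{R}^d$ taking almost surely non-negative values, with $X$ and $\Gamma$ independent, and let $\Psi=(\Psi_1,\Psi_2)$ be the random field model $$\Psi_i(B)=\int_B\Gamma_i(x)1\{x\in X_i\}\,dx,\qquad i=1,2.$$ Suppose that $\Gamma$ admits a continuous version and that its associated random measure $\left(\int_{\cdot}\Gamma_1(x)\,dx,\int_{\cdot}\Gamma_2(x)\,dx\right)$ is coverage-reweighted moment stationary. Furthermore, assume that $X$ is stationary and has strictly positive volume fractions $\mathbb{P}(0\in X_i)$, $i=1,2$. Then the random field model $\Psi$ is coverage-reweighted moment stationary and, writing $c_{12}^X$ and $c_{12}^\Gamma$ for the coverage-reweighted cross covariance functions of $X$ and $\Gamma$ respectively, for $t\ge0$, $$K_{12}(t)=\int_{B(0,t)}(c_{12}^X(0,x)+1)\,(c_{12}^\Gamma(0,x)+1)\,dx;$$ and, for $t\ge0$ such that the moment expansion of $L(u_t^0)$ and the series defining $J_{12}(t)$ are absolutely convergent, $$J_{12}(t)=\frac{\mathbb{E}\left(\Gamma_1(0)\exp\left[-\frac1{\mathbb{P}(0\in X_2)}\int_{B(0,t)\cap X_2}\frac{\Gamma_2(x)}{\mathbb{E}\Gamma_2(x)}\,dx\right]\Big|\,0\in X_1\right)}{\mathbb{E}\Gamma_1(0)\;\mathbb{E}\exp\left[-\frac1{\mathbb{P}(0\in X_2)}\int_{B(0,t)\cap X_2}\f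rac{\Gamma_2(x)}{\mathbb{E}\Gamma_2(x)}\,dx\right]}.$$
   Context: $B(a,t)$ is the closed ball of radius $t\ge0$ centred at $a\in\mathbb{R}^d$. $X$ is stationary if the joint distribution of $(X_1,X_2)$ is invariant under common translations. Random measures. A bivariate random measure $\Psi=(\Psi_1,\Psi_2)$ on $\mathbb{R}^d$ is a measurable map from a probability space into the locally finite Borel measures on $\mathbb{R}^d\times\{1,2\}$; $\Psi_i(B)$ is the mass of $B\times\{i\}$. Its $k$-th order moment measure is $\mu^{(k)}((B_1\times\{i_1\})\times\cdots\times(B_k\times\{i_k\}))=\mathbb{E}(\Psi_{i_1}(B_1)\cdots\Psi_{i_k}(B_k))$, assumed locally finite. If it equals $\int_{B_1}\cdots\int_{B_k}p_k((x_1,i_1),\dots,(x_k,i_k))\,dx_1\cdots dx_k$, then $p_k$ is the $k$-point coverage function. Cumulant densities. If all $p_k$ exist and $p_1>0$, define recursively $\xi_1\equiv1$ and, for $k\ge2$, $$\frac{p_k((x_1,i_1),\dots,(x_k,i_k))}{p_1(x_1,i_1)\cdots p_1(x_k,i_k)}=\sum_{m=1}^k\sum_{D_1,\dots,D_m}\prod_{j=1}^m\xi_{|D_j|}(\{(x_l,i_l):l\in D_j\}),$$ the inner sum being over all partitions of $\{1,\dots,k\}$ into $m$ non-empty sets. A random measure is coverage-reweighted moment stationary if its moment measures of all orders exist and are absolutely continuous, $\inf p_1(x,i)>0$, and every $\xi_k$ is translation invariant: $\xi_k((x_1+a,i_1),\dots,(x_k+a,i_k))=\xi_k((x_1,i_1),\dots,(x_k,i_k))$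 for all $a$ and all labels (for almost all $x_j$). Versions. For the random measure associated with $\Gamma$ one takes $p_k^\Gamma((x_1,i_1),\dots,(x_k,i_k))=\mathbb{E}[\Gamma_{i_1}(x_1)\cdots\Gamma_{i_k}(x_k)]$, for $X$ one takes $p_k^X((x_1,i_1),\dots,(x_k,i_k))=\mathbb{P}(x_1\in X_{i_1};\dots;x_k\in X_{i_k})$, and for $\Psi$ the product $p_k=p_k^Xp_k^\Gamma$; translation invariance for $\Gamma$ is understood to hold for these versions, so that evaluating at the origin is meaningful. The coverage-reweighted cross covariance functions are $$c_{12}^X(0,x)=\frac{\mathbb{P}(0\in X_1;x\in X_2)}{\mathbb{P}(0\in X_1)\mathbb{P}(x\in X_2)}-1,\qquad c_{12}^\Gamma(0,x)=\frac{\mathbb{E}[\Gamma_1(0)\Gamma_2(x)]}{\mathbb{E}\Gamma_1(0)\,\mathbb{E}\Gamma_2(x)}-1.$$ Cross statistics of $\Psi$: $$K_{12}(t)=\int_{B(0,t)}(1+\xi_2((0,1),(x,2)))\,dx,$$ $$J_{12}(t)=1+\sum_{k=1}^\infty\frac{(-1)^k}{k!}\int_{B(0,t)}\cdots\int_{B(0,t)}\xi_{k+1}((0,1),(x_1,2),\dots,(x_k,2))\,dx_1\cdots dx_k,$$ the latter for $t$ such that the series is absolutely convergent. Laplace functional: $L(u)=\mathbb{E}\exp[-\sum_i\int u(x,i)\,d\Psi_i(x)]$; $u_t^0(x,i)=1\{(x,i)\in B(0,t)\times\{2\}\}/p_1(x,i)$. The moment expansion of $L(u)$ is $1+\sum_{k\ge1}\frac{(-1)^k}{k!}\int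 u(x_1,i_1)\cdots u(x_k,i_k)\,d\mu^{(k)}((x_1,i_1),\dots,(x_k,i_k))$. *)

theory Defs
  imports "HOL-Probability.Probability" "HOL-Library.Disjoint_Sets"
begin

datatype component = One | Two

text \<open>
  A \<open>k\<close>-tuple of marked points is a list of length \<open>k\<close>, so a family \<open>(p_k)\<close> of functions of
  \<open>k\<close>-tuples is one function on lists. Integration variables in \<open>(R^d)^k\<close> are functions on
  \<open>{..<k}\<close>; \<open>marked k x I\<close> is the tuple of the points \<open>x j\<close> with labels \<open>I j\<close>.
\<close>

definition marked :: "nat \<Rightarrow> (nat \<Rightarrow> 'a) \<Rightarrow> (nat \<Rightarrow> component) \<Rightarrow> ('a \<times> component) list" where
  "marked k x I = map (\<lambda>j. (x j, I j)) [0..<k]"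

definition shift :: "'a::euclidean_space \<Rightarrow> ('a \<times> component) list \<Rightarrow> ('a \<times> component) list" where
  "shift a ys = map (\<lambda>(x, i). (x + a, i)) ys"

abbreviation lebesgue_power :: "nat \<Rightarrow> (nat \<Rightarrow> 'a::euclidean_space) measure" where
  "lebesgue_power k \<equiv> Pi\<^sub>M {..<k} (\<lambda>_. lborel)"

abbreviation marked_space :: "('a::euclidean_space \<times> component) measure" where
  "marked_space \<equiv> lborel \<Otimes>\<^sub>M count_space UNIV"

text \<open>
  Measurability is with respect to the smallest sigma-algebra on the locally finite measures
  that makes all evaluations measurable.
\<close>

definition bivariate_random_measure ::
    "'w measure \<Rightarrow> ('w \<Rightarrow> ('a::euclidean_space \<times> component) measure) \<Rightarrow> bool" where
  "bivariate_random_measure M \<Psi> \<longleftrightarrow>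
     (\<forall>\<omega>\<in>space M. sets (\<Psi> \<omega>) = sets marked_space \<and>
        (\<forall>K. compact K \<longrightarrow> emeasure (\<Psi> \<omega>) (K \<times> UNIV) < \<infinity>)) \<and>
     (\<forall>B\<in>sets borel. \<forall>i. (\<lambda>\<omega>. emeasure (\<Psi> \<omega>) (B \<times> {i})) \<in> borel_measurable M)"

definition is_moment_measure ::
    "'w measure \<Rightarrow> ('w \<Rightarrow> ('a::euclidean_space \<times> component) measure) \<Rightarrow> nat \<Rightarrow>
     (nat \<Rightarrow> 'a \<times> component) measure \<Rightarrow> bool" where
  "is_moment_measure M \<Psi> k N \<longleftrightarrow>
     sets N = sets (Pi\<^sub>M {..<k} (\<lambda>_. marked_space)) \<and>
     (\<forall>B I. (\<forall>j<k. B j \<in> sets borel) \<longrightarrow>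
        emeasure N (Pi\<^sub>E {..<k} (\<lambda>j. B j \<times> {I j})) =
        (\<integral>\<^sup>+\<omega>. (\<Prod>j<k. emeasure (\<Psi> \<omega>) (B j \<times> {I j})) \<partial>M)) \<and>
     (\<forall>K. compact K \<longrightarrow> emeasure N (Pi\<^sub>E {..<k} (\<lambda>_. K \<times> UNIV)) < \<infinity>)"

text \<open>A locally finite measure is determined by its values on rectangles.\<close>

definition moment_measure ::
    "'w measure \<Rightarrow> ('w \<Rightarrow> ('a::euclidean_space \<times> component) measure) \<Rightarrow> nat \<Rightarrow>
     (nat \<Rightarrow> 'a \<times> component) measure" where
  "moment_measure M \<Psi> k = (THE N. is_moment_measure M \<Psi> k N)"

definition is_coverage_function ::
    "'w measure \<Rightarrow> ('w \<Rightarrow> ('a::euclidean_space \<times> component) measure) \<Rightarrow> nat \<Rightarrow>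
     (('a \<times> component) list \<Rightarrow> real) \<Rightarrow> bool" where
  "is_coverage_function M \<Psi> k p \<longleftrightarrow>
     (\<exists>N. is_moment_measure M \<Psi> k N \<and>
       (\<forall>I. (\<forall>x. 0 \<le> p (marked k x I)) \<and>
            (\<lambda>x. p (marked k x I)) \<in> borel_measurable (lebesgue_power k) \<and>
            (\<forall>B. (\<forall>j<k. B j \<in> sets borel) \<longrightarrow>
               emeasure N (Pi\<^sub>E {..<k} (\<lambda>j. B j \<times> {I j})) =
               (\<integral>\<^sup>+x\<in>Pi\<^sub>E {..<k} B. ennreal (p (marked k x I)) \<partial>lebesgue_power k))))"

text \<open>
  The defining recursion is solved for the term of the one-block partition;
  \<open>cumulant_recursion\<close> below restates it with the sum over all partitions. \<open>nths ys D\<close> is the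
  subtuple of \<open>ys\<close> with positions in \<open>D\<close>.
\<close>

lemma partition_block_less:
  assumes "partition_on {..<n::nat} P" "P \<noteq> {{..<n}}" "D \<in> P"
  shows "D \<subset> {..<n}"
proof -
  have sub: "D \<subseteq> {..<n}"
    using assms by (auto simp: partition_on_def)
  moreover have "D \<noteq> {..<n}"
  proof
    assume D: "D = {..<n}"
    have "E = D" if "E \<in> P" for E
    proof (rule ccontr)
      assume "E \<noteq> D"
      then have "E \<inter> D = {}"
        using assms that by (auto simp: partition_on_def disjoint_def)
      moreover have "E \<subseteq> D" "E \<noteq> {}"
        using assms that D by (auto simp: partition_on_def)
      ultimately show False by blast
    qed
    then have "P = {D}" using assms(3) by blast
    then show False using assms(2) D by simp
  qed
  ultimately show ?thesis by blast
qed

lemma length_nths_partition_block: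
  assumes "partition_on {..<length ys} P" "P \<noteq> {{..<length ys}}" "D \<in> P"
  shows "length (nths ys D) < length ys"
proof -
  have "D \<subset> {..<length ys}" using partition_block_less[OF assms] .
  then have "card D < length ys" using psubset_card_mono[of "{..<length ys}" D] by simp
  moreover have "{i. i < length ys \<and> i \<in> D} = D"
    using \<open>D \<subset> {..<length ys}\<close> by auto
  ultimately show ?thesis by (simp add: length_nths)
qed

function cumulant :: "('b list \<Rightarrow> real) \<Rightarrow> 'b list \<Rightarrow> real" where
  "cumulant p ys =
     (if length ys \<le> 1 then 1
      else p ys / (\<Prod>y\<leftarrow>ys. p [y]) -
        (\<Sum>P\<in>{P. partition_on {..<length ys} P \<and> P \<noteq> {{..<length ys}}}.
           \<Prod>D\<in>P. cumulant p (nths ys D)))"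
  by auto
termination
  by (relation "Wellfounded.measure (\<lambda>(p, ys). length ys)") (auto intro: length_nths_partition_block)

declare cumulant.simps [simp del]

lemma cumulant_recursion:
  assumes "2 \<le> length ys"
  shows "p ys / (\<Prod>y\<leftarrow>ys. p [y]) =
    (\<Sum>P | partition_on {..<length ys} P. \<Prod>D\<in>P. cumulant p (nths ys D))"
proof -
  let ?A = "{..<length ys}"
  have part: "partition_on ?A {?A}"
  proof (rule partition_on_space)
    have "0 \<in> ?A" using assms by auto
    then show "?A \<noteq> {}" by blast
  qed
  have fin: "finite {P. partition_on ?A P}"
    by (rule finitely_many_partition_on) simp
  have "{P. partition_on ?A P} - {{?A}} = {P. partition_on ?A P \<and> P \<noteq> {?A}}" by auto
  with sum.remove[OF fin, of "{?A}" "\<lambda>P. \<Prod>D\<in>P. cumulant p (nths ys D)"] part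
  have "(\<Sum>P | partition_on ?A P. \<Prod>D\<in>P. cumulant p (nths ys D)) =
     cumulant p (nths ys ?A) +
     (\<Sum>P | partition_on ?A P \<and> P \<noteq> {?A}. \<Prod>D\<in>P. cumulant p (nths ys D))"
    by simp
  moreover have "nths ys ?A = ys" by (simp add: nths_all)
  ultimately show ?thesis
    using assms by (simp add: cumulant.simps[of p ys])
qed

text \<open>
  The coverage functions are determined up to null sets only; the argument \<open>p\<close> records the
  versions in use.
\<close>

definition coverage_reweighted_moment_stationary ::
    "'w measure \<Rightarrow> ('w \<Rightarrow> ('a::euclidean_space \<times> component) measure) \<Rightarrow>
     (('a \<times> component) list \<Rightarrow> real) \<Rightarrow> bool" where
  "coverage_reweighted_moment_stationary M \<Psi> p \<longleftrightarrow>
     bivariate_random_measure M \<Psi> \<and>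
     (\<forall>k\<ge>1. is_coverage_function M \<Psi> k p) \<and>
     0 < (INF y. p [y]) \<and>
     (\<forall>k\<ge>1. \<forall>a I. AE x in lebesgue_power k.
        cumulant p (shift a (marked k x I)) = cumulant p (marked k x I))"

definition K12 :: "(('a::euclidean_space \<times> component) list \<Rightarrow> real) \<Rightarrow> real \<Rightarrow> real" where
  "K12 p t = (LINT x:cball 0 t|lborel. 1 + cumulant p [(0, One), (x, Two)])"

definition J12_integrand ::
    "(('a::euclidean_space \<times> component) list \<Rightarrow> real) \<Rightarrow> nat \<Rightarrow> (nat \<Rightarrow> 'a) \<Rightarrow> real" where
  "J12_integrand p k x = cumulant p ((0, One) # marked k x (\<lambda>_. Two))"

definition J12_term ::
    "(('a::euclidean_space \<times> component) list \<Rightarrow> real) \<Rightarrow> real \<Rightarrow> nat \<Rightarrow> real" where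
  "J12_term p t k = (-1) ^ k / fact k *
     (LINT x:Pi\<^sub>E {..<k} (\<lambda>_. cball 0 t)|lebesgue_power k. J12_integrand p k x)"

definition J12 :: "(('a::euclidean_space \<times> component) list \<Rightarrow> real) \<Rightarrow> real \<Rightarrow> real" where
  "J12 p t = 1 + (\<Sum>k. J12_term p t (Suc k))"

definition J12_absolutely_convergent ::
    "(('a::euclidean_space \<times> component) list \<Rightarrow> real) \<Rightarrow> real \<Rightarrow> bool" where
  "J12_absolutely_convergent p t \<longleftrightarrow>
     (\<forall>k\<ge>1. set_integrable (lebesgue_power k) (Pi\<^sub>E {..<k} (\<lambda>_. cball 0 t)) (J12_integrand p k)) \<and>
     summable (\<lambda>k. \<bar>J12_term p t (Suc k)\<bar>)"

definition u0 ::
    "(('a::euclidean_space \<times> component) list \<Rightarrow> real) \<Rightarrow> real \<Rightarrow> 'a \<times> component \<Rightarrow> real" where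
  "u0 p t y = indicator (cball 0 t \<times> {Two}) y / p [y]"

definition moment_expansion_term ::
    "'w measure \<Rightarrow> ('w \<Rightarrow> ('a::euclidean_space \<times> component) measure) \<Rightarrow>
     ('a \<times> component \<Rightarrow> real) \<Rightarrow> nat \<Rightarrow> real" where
  "moment_expansion_term M \<Psi> u k =
     (-1) ^ k / fact k * (LINT y|moment_measure M \<Psi> k. (\<Prod>j<k. u (y j)))"

definition moment_expansion_absolutely_convergent ::
    "'w measure \<Rightarrow> ('w \<Rightarrow> ('a::euclidean_space \<times> component) measure) \<Rightarrow>
     ('a \<times> component \<Rightarrow> real) \<Rightarrow> bool" where
  "moment_expansion_absolutely_convergent M \<Psi> u \<longleftrightarrow>
     (\<forall>k\<ge>1. integrable (moment_measure M \<Psi> k) (\<lambda>y. \<Prod>j<k. u (y j))) \<and>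
     summable (\<lambda>k. \<bar>moment_expansion_term M \<Psi> u (Suc k)\<bar>)"

text \<open>
  The closed sets with the Borel sigma-algebra of the Fell topology, which is generated by the
  families of closed sets hitting a given compact set.
\<close>

definition fell :: "'a::euclidean_space set measure" where
  "fell = sigma {F. closed F} {{F. closed F \<and> F \<inter> K \<noteq> {}} | K. compact K}"

definition bivariate_random_closed_set ::
    "'w measure \<Rightarrow> (component \<Rightarrow> 'w \<Rightarrow> 'a::euclidean_space set) \<Rightarrow> bool" where
  "bivariate_random_closed_set M X \<longleftrightarrow> (\<lambda>\<omega> i. X i \<omega>) \<in> M \<rightarrow>\<^sub>M Pi\<^sub>M UNIV (\<lambda>_. fell)"

definition stationary_closed_set ::
    "'w measure \<Rightarrow> (component \<Rightarrow> 'w \<Rightarrow> 'a::euclidean_space set) \<Rightarrow> bool" where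
  "stationary_closed_set M X \<longleftrightarrow>
     (\<forall>a. distr M (Pi\<^sub>M UNIV (\<lambda>_. fell)) (\<lambda>\<omega> i. (\<lambda>x. x + a) ` X i \<omega>) =
          distr M (Pi\<^sub>M UNIV (\<lambda>_. fell)) (\<lambda>\<omega> i. X i \<omega>))"

definition coverage_X ::
    "'w measure \<Rightarrow> (component \<Rightarrow> 'w \<Rightarrow> 'a set) \<Rightarrow> ('a \<times> component) list \<Rightarrow> real" where
  "coverage_X M X ys = \<P>(\<omega> in M. \<forall>(x, i)\<in>set ys. x \<in> X i \<omega>)"

definition c12_X ::
    "'w measure \<Rightarrow> (component \<Rightarrow> 'w \<Rightarrow> 'a::euclidean_space set) \<Rightarrow> 'a \<Rightarrow> real" where
  "c12_X M X x =
     \<P>(\<omega> in M. 0 \<in> X One \<omega> \<and> x \<in> X Two \<omega>) /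
     (\<P>(\<omega> in M. 0 \<in> X One \<omega>) * \<P>(\<omega> in M. x \<in> X Two \<omega>)) - 1"

text \<open>
  Joint measurability makes the integrals over sample paths meaningful.
\<close>

definition bivariate_random_field ::
    "'w measure \<Rightarrow> (component \<Rightarrow> 'a::euclidean_space \<Rightarrow> 'w \<Rightarrow> real) \<Rightarrow> bool" where
  "bivariate_random_field M \<Gamma> \<longleftrightarrow>
     (\<forall>i. (\<lambda>(\<omega>, x). \<Gamma> i x \<omega>) \<in> borel_measurable (M \<Otimes>\<^sub>M borel))"

definition has_continuous_version ::
    "'w measure \<Rightarrow> (component \<Rightarrow> 'a::euclidean_space \<Rightarrow> 'w \<Rightarrow> real) \<Rightarrow> bool" where
  "has_continuous_version M \<Gamma> \<longleftrightarrow>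
     (\<exists>\<Gamma>'. (\<forall>i x. \<Gamma>' i x \<in> borel_measurable M) \<and>
           (\<forall>i. \<forall>\<omega>\<in>space M. continuous_on UNIV (\<lambda>x. \<Gamma>' i x \<omega>)) \<and>
           (\<forall>i x. AE \<omega> in M. \<Gamma>' i x \<omega> = \<Gamma> i x \<omega>))"

definition coverage_field ::
    "'w measure \<Rightarrow> (component \<Rightarrow> 'a \<Rightarrow> 'w \<Rightarrow> real) \<Rightarrow> ('a \<times> component) list \<Rightarrow> real" where
  "coverage_field M \<Gamma> ys = (LINT \<omega>|M. (\<Prod>(x, i)\<leftarrow>ys. \<Gamma> i x \<omega>))"

definition c12_field ::
    "'w measure \<Rightarrow> (component \<Rightarrow> 'a::euclidean_space \<Rightarrow> 'w \<Rightarrow> real) \<Rightarrow> 'a \<Rightarrow> real" where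
  "c12_field M \<Gamma> x =
     (LINT \<omega>|M. \<Gamma> One 0 \<omega> * \<Gamma> Two x \<omega>) /
     ((LINT \<omega>|M. \<Gamma> One 0 \<omega>) * (LINT \<omega>|M. \<Gamma> Two x \<omega>)) - 1"

text \<open>
  Independence of the generated sigma-algebras. The library's notion of two independent
  random variables only applies to variables with values in the same type.
\<close>

definition independent_set_field ::
    "'w measure \<Rightarrow> (component \<Rightarrow> 'w \<Rightarrow> 'a::euclidean_space set) \<Rightarrow>
     (component \<Rightarrow> 'a \<Rightarrow> 'w \<Rightarrow> real) \<Rightarrow> bool" where
  "independent_set_field M X \<Gamma> \<longleftrightarrow>
     prob_space.indep_set M
       (sets (vimage_algebra (space M) (\<lambda>\<omega> i. X i \<omega>) (Pi\<^sub>M UNIV (\<lambda>_. fell))))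
       (sets (vimage_algebra (space M) (\<lambda>\<omega> (i, x). \<Gamma> i x \<omega>) (Pi\<^sub>M UNIV (\<lambda>_. borel))))"

text \<open>\<^term>\<open>ennreal\<close> truncates negative values of \<open>\<Gamma>\<close> to zero.\<close>

definition field_measure ::
    "(component \<Rightarrow> 'a::euclidean_space \<Rightarrow> 'w \<Rightarrow> real) \<Rightarrow> 'w \<Rightarrow> ('a \<times> component) measure" where
  "field_measure \<Gamma> \<omega> = density marked_space (\<lambda>(x, i). ennreal (\<Gamma> i x \<omega>))"

definition random_field_model ::
    "(component \<Rightarrow> 'w \<Rightarrow> 'a::euclidean_space set) \<Rightarrow> (component \<Rightarrow> 'a \<Rightarrow> 'w \<Rightarrow> real) \<Rightarrow>
     'w \<Rightarrow> ('a \<times> component) measure" where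
  "random_field_model X \<Gamma> \<omega> =
     density marked_space (\<lambda>(x, i). ennreal (\<Gamma> i x \<omega>) * indicator (X i \<omega>) x)"

lemma UNIV_component: "UNIV = {One, Two}"
  by (auto intro: component.exhaust)

instance component :: finite
  by standard (simp add: UNIV_component)

lemma emeasure_random_field_model:
  assumes \<Gamma>: "\<And>i. (\<lambda>x. \<Gamma> i x \<omega>) \<in> borel_measurable borel"
    and X: "\<And>i. closed (X i \<omega>)" and B: "B \<in> sets borel"
  shows "emeasure (random_field_model X \<Gamma> \<omega>) (B \<times> {i}) =
    (\<integral>\<^sup>+x\<in>B. ennreal (\<Gamma> i x \<omega>) * indicator (X i \<omega>) x \<partial>lborel)"
proof -
  interpret C: sigma_finite_measure "count_space (UNIV :: component set)"
    by (rule sigma_finite_measure_count_space_finite) simp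
  interpret P: pair_sigma_finite "lborel :: 'a measure" "count_space (UNIV :: component set)" ..
  let ?f = "\<lambda>(x, i). ennreal (\<Gamma> i x \<omega>) * indicator (X i \<omega>) x"
  have m: "?f \<in> borel_measurable (marked_space :: ('a \<times> component) measure)"
  proof -
    have "(\<lambda>x. ennreal (\<Gamma> j x \<omega>) * indicator (X j \<omega>) x) \<in> borel_measurable lborel" for j
    proof -
      have [measurable]: "(\<lambda>x. \<Gamma> j x \<omega>) \<in> borel_measurable borel" "X j \<omega> \<in> sets borel"
        using \<Gamma>[of j] X[of j] by (auto intro: borel_closed)
      show ?thesis by measurable
    qed
    then have "(\<lambda>y. ennreal (\<Gamma> (snd y) (fst y) \<omega>) * indicator (X (snd y) \<omega>) (fst y))
        \<in> borel_measurable (marked_space :: ('a \<times> component) measure)"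
      by (intro measurable_compose_countable'[where I = UNIV and
            f = "\<lambda>j y. ennreal (\<Gamma> j (fst y) \<omega>) * indicator (X j \<omega>) (fst y)" and g = snd])
        (auto intro: measurable_compose[OF measurable_fst])
    then show ?thesis by (simp add: case_prod_beta')
  qed
  have BI: "B \<times> {i} \<in> sets (marked_space :: ('a \<times> component) measure)"
    using B by (intro pair_measureI) auto
  have "emeasure (random_field_model X \<Gamma> \<omega>) (B \<times> {i}) =
      (\<integral>\<^sup>+y. ?f y * indicator (B \<times> {i}) y \<partial>marked_space)"
    unfolding random_field_model_def using m BI by (rule emeasure_density)
  also have "\<dots> = (\<integral>\<^sup>+x. \<integral>\<^sup>+j. ?f (x, j) * indicator (B \<times> {i}) (x, j)
      \<partial>count_space UNIV \<partial>lborel)"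
    using m BI by (intro C.nn_integral_fst[symmetric]) auto
  also have "\<dots> = (\<integral>\<^sup>+x. ?f (x, i) * indicator B x \<partial>lborel)"
  proof (intro nn_integral_cong)
    fix x
    show "(\<integral>\<^sup>+j. ?f (x, j) * indicator (B \<times> {i}) (x, j) \<partial>count_space UNIV) =
        ?f (x, i) * indicator B x"
    proof -
      have "(\<Sum>j\<in>UNIV. ?f (x, j) * indicator (B \<times> {i}) (x, j)) =
          (\<Sum>j\<in>{i}. ?f (x, j) * indicator (B \<times> {i}) (x, j))"
        by (rule sum.mono_neutral_right) (auto simp: indicator_def)
      also have "\<dots> = ?f (x, i) * indicator B x"
        by (simp add: indicator_def)
      finally show ?thesis
        by (subst nn_integral_count_space_finite) auto
    qed
  qed
  finally show ?thesis by simp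
qed

definition coverage_model ::
    "'w measure \<Rightarrow> (component \<Rightarrow> 'w \<Rightarrow> 'a set) \<Rightarrow> (component \<Rightarrow> 'a \<Rightarrow> 'w \<Rightarrow> real) \<Rightarrow>
     ('a \<times> component) list \<Rightarrow> real" where
  "coverage_model M X \<Gamma> ys = coverage_X M X ys * coverage_field M \<Gamma> ys"

definition void_factor ::
    "'w measure \<Rightarrow> (component \<Rightarrow> 'w \<Rightarrow> 'a::euclidean_space set) \<Rightarrow>
     (component \<Rightarrow> 'a \<Rightarrow> 'w \<Rightarrow> real) \<Rightarrow> real \<Rightarrow> 'w \<Rightarrow> real" where
  "void_factor M X \<Gamma> t \<omega> =
     exp (- (1 / \<P>(\<omega>' in M. 0 \<in> X Two \<omega>') *
       (LINT x:cball 0 t \<inter> X Two \<omega>|lborel. \<Gamma> Two x \<omega> / (LINT \<omega>'|M. \<Gamma> Two x \<omega>'))))"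

end

theory Submission
  imports Defs
begin

text \<open>
  Write \<open>p\<close> for the coverage functions of the model. By independence and stationarity of \<open>X\<close>
  they factor into the probabilities \<open>P(x\<^sub>1 \<in> X, \<dots>)\<close>, which are invariant under translations,
  and the moments of \<open>\<Gamma>\<close>. The same holds for the normalised functions
  \<open>p(x\<^sub>1, \<dots>, x\<^sub>k) / (p(x\<^sub>1) \<cdots> p(x\<^sub>k))\<close>, called \<^term>\<open>reweighted\<close> below. They carry the same
  information as the cumulants: each is a sum over partitions of products of cumulants, and that
  relation can be solved for the cumulants (\<open>reweighted_shift_invariant\<close>,
  \<open>cumulant_shift_invariant\<close>). Hence invariance of the cumulants of \<open>\<Gamma>\<close> passes to
  those of the model, and the formula for the cross \<open>K\<close>-function is the case of two points, in
  which \<open>1 + \<xi>\<^sub>2\<close> is the reweighted function itself. That the products \<open>p\<close> are the coverage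
  functions of the model is Tonelli's theorem, applied on the product of the probability space with
  \<open>(R\<^sup>d)\<^sup>k\<close>; it needs that \<open>{(\<omega>, x). x \<in> X(\<omega>)}\<close> is jointly measurable
  (\<open>joint_membership\<close>).

  For the cross \<open>J\<close>-function put \<open>Y = \<integral> u\<^sub>t\<^sup>0 d\<Psi>\<close> and
  \<open>Z = \<Gamma>\<^sub>1(0) 1{0 \<in> X\<^sub>1} / p(0, 1)\<close>. Both are non-negative, \<open>exp (- Y)\<close> is almost surely the void factor of
  the statement, and the claim becomes \<open>E (Z exp (- Y)) = J\<^sub>1\<^sub>2(t) E (exp (- Y))\<close>. By Tonelli,
  \<open>E (Y\<^sup>k)\<close> and \<open>E (Z Y\<^sup>k)\<close> are the integrals over \<open>B(0, t)\<^sup>k\<close> of the reweighted functions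
  of \<open>x\<^sub>1, \<dots>, x\<^sub>k\<close> and of \<open>0, x\<^sub>1, \<dots>, x\<^sub>k\<close>. Sorting the partitions of the latter points by the
  block that contains the origin (\<open>reweighted_Cons\<close>) gives
  \<open>E (Z Y\<^sup>k) = \<Sum>j\<le>k. (k choose j) a\<^sub>j E (Y\<^bsup>k - j\<^esup>)\<close>, where \<open>a\<^sub>j\<close> is the \<open>j\<close>-th
  integral in the series of \<open>J\<^sub>1\<^sub>2\<close> (\<open>palm_moment_convolution\<close>). So the
  exponential series of \<open>E (Z exp (- Y))\<close> is the Cauchy product of the series of \<open>J\<^sub>1\<^sub>2(t)\<close> and
  of \<open>E (exp (- Y))\<close>. Both factors converge absolutely; because \<open>Y\<close> and \<open>Z\<close> are
  non-negative, absolute convergence of the numerical series is all that is needed to exchange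
  expectation and summation (\<open>expectation_exp_series\<close>).
\<close>

section \<open>Reweighted coverage functions and cumulants\<close>

definition reweighted :: "('b list \<Rightarrow> real) \<Rightarrow> 'b list \<Rightarrow> real" where
  "reweighted p ys = p ys / (\<Prod>y\<leftarrow>ys. p [y])"

lemma partition_on_singleton_iff: "partition_on {a} P \<longleftrightarrow> P = {{a}}"
proof
  assume P: "partition_on {a} P"
  have "D = {a}" if "D \<in> P" for D
  proof -
    have "D \<noteq> {}" "D \<subseteq> {a}"
      using P that by (auto simp: partition_on_def)
    then show ?thesis by blast
  qed
  moreover have "P \<noteq> {}"
    using P by (auto simp: partition_on_def)
  ultimately show "P = {{a}}" by blast
qed (simp add: partition_on_space)

text \<open>
  The defining recursion of the cumulants covers tuples of length at least two; normalisation
  extends it to the empty tuple, which has the empty partition only, and to single points. This makes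
  it available for every block of a partition.
\<close>

lemma reweighted_eq_partition_sum:
  assumes "p [] = 1" "\<And>y. p [y] \<noteq> 0"
  shows "reweighted p ys =
    (\<Sum>P | partition_on {..<length ys} P. \<Prod>D\<in>P. cumulant p (nths ys D))"
proof -
  consider "ys = []" | y where "ys = [y]" | "2 \<le> length ys"
    by (cases ys; cases "tl ys") auto
  then show ?thesis
  proof cases
    case 1
    then show ?thesis using assms by (simp add: reweighted_def partition_on_empty)
  next
    case 2
    have "{..<Suc 0} = {0}" by auto
    then show ?thesis using 2 assms
      by (simp add: reweighted_def partition_on_singleton_iff nths_singleton cumulant.simps)
  next
    case 3
    then show ?thesis by (simp add: reweighted_def cumulant_recursion)
  qed
qed

abbreviation position :: "nat set \<Rightarrow> nat \<Rightarrow> nat" where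
  "position A i \<equiv> card {j \<in> A. j < i}"

lemma bij_betw_position:
  assumes "finite A"
  shows "bij_betw (position A) A {..<card A}"
proof -
  have mono: "position A i < position A j" if "i \<in> A" "j \<in> A" "i < j" for i j
    using assms that by (intro psubset_card_mono) auto
  have inj: "inj_on (position A) A"
    by (rule inj_onI) (metis mono nat_neq_iff)
  have "position A ` A = {..<card A}"
  proof (rule card_subset_eq)
    show "position A ` A \<subseteq> {..<card A}"
      using assms by (auto intro!: psubset_card_mono)
  qed (use inj in \<open>auto simp: card_image\<close>)
  with inj show ?thesis by (simp add: bij_betw_def)
qed

lemma position_less:
  assumes "finite A" "i \<in> A"
  shows "position A i < card A"
  using assms by (intro psubset_card_mono) auto

text \<open>
  Selecting \<open>A\<close> from a list renumbers the entries by their position in \<open>A\<close>.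
\<close>

lemma nths_nths_position:
  assumes "finite A" "D \<subseteq> A"
  shows "nths (nths xs A) (position A ` D) = nths xs D"
proof -
  have "inj_on (position A) A"
    using bij_betw_position[OF assms(1)] by (rule bij_betw_imp_inj_on)
  then have "{i \<in> A. \<exists>j\<in>position A ` D. position A i = j} = D"
    using assms(2) by (auto dest: inj_onD)
  then show ?thesis unfolding nths_nths by simp
qed

text \<open>
  The same sum for a subtuple, indexed by partitions of the set of selected positions rather than of
  an initial segment: the order isomorphism \<^term>\<open>position A\<close> carries one kind of partition to
  the other.
\<close>

lemma reweighted_nths:
  assumes "p [] = 1" "\<And>y. p [y] \<noteq> 0" and A: "A \<subseteq> {..<length ys}"
  shows "reweighted p (nths ys A) = (\<Sum>P | partition_on A P. \<Prod>D\<in>P. cumulant p (nths ys D))"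
proof -
  have fin: "finite A" using A finite_subset by blast
  define f where "f = position A"
  have inj: "inj_on f A" and img: "f ` A = {..<card A}"
    using bij_betw_position[OF fin] by (auto simp: bij_betw_def f_def)
  have "{i. i < length ys \<and> i \<in> A} = A" using A by auto
  then have len: "length (nths ys A) = card A" by (simp add: length_nths)
  define g where "g = the_inv_into A f"
  have gf: "g (f a) = a" if "a \<in> A" for a using inj that by (simp add: g_def the_inv_into_f_f)
  have fg: "f (g b) = b" if "b < card A" for b
    using inj that img by (simp add: g_def f_the_inv_into_f)
  have injg: "inj_on g {..<card A}" by (metis fg inj_onI lessThan_iff)
  have gfD: "g ` f ` D = D" if "D \<subseteq> A" for D
    using image_cong[of D D "\<lambda>i. g (f i)" "\<lambda>i. i"] gf that by (simp add: image_image subset_iff)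
  have fgD: "f ` g ` D = D" if "D \<subseteq> {..<card A}" for D
    using image_cong[of D D "\<lambda>i. f (g i)" "\<lambda>i. i"] fg that by (simp add: image_image subset_iff)
  have gimg: "g ` {..<card A} = A" using gfD[of A] img by simp
  have "(\<Sum>P | partition_on A P. \<Prod>D\<in>P. cumulant p (nths ys D)) =
      (\<Sum>P | partition_on {..<card A} P. \<Prod>D\<in>P. cumulant p (nths (nths ys A) D))"
  proof (rule sum.reindex_bij_witness[where i = "(`) ((`) g)" and j = "(`) ((`) f)"])
    fix P assume "P \<in> {P. partition_on A P}"
    then have P: "partition_on A P" by simp
    then have sub: "D \<subseteq> A" if "D \<in> P" for D using that by (auto simp: partition_on_def)
    show "(`) g ` (`) f ` P = P" using image_cong[of P P "\<lambda>D. g ` f ` D" "\<lambda>D. D"] gfD sub by (simp add: image_image[of "(`) g"])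
    show "(`) f ` P \<in> {P. partition_on {..<card A} P}"
      using partition_on_inj_image[OF P inj] img partition_onD3[OF P] by (simp add: image_iff)
    have "inj_on ((`) f) P"
      by (metis gfD inj_onI sub)
    then show "(\<Prod>D\<in>(`) f ` P. cumulant p (nths (nths ys A) D)) = (\<Prod>D\<in>P. cumulant p (nths ys D))"
      using sub by (simp add: prod.reindex nths_nths_position[OF fin] f_def)
  next
    fix P assume "P \<in> {P. partition_on {..<card A} P}"
    then have P: "partition_on {..<card A} P" by simp
    then have sub: "D \<subseteq> {..<card A}" if "D \<in> P" for D using that by (auto simp: partition_on_def)
    show "(`) f ` (`) g ` P = P" using image_cong[of P P "\<lambda>D. f ` g ` D" "\<lambda>D. D"] fgD sub by (simp add: image_image[of "(`) f"])
    show "(`) g ` P \<in> {P. partition_on A P}"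
      using partition_on_inj_image[OF P injg] gimg partition_onD3[OF P] by (simp add: image_iff)
  qed
  then show ?thesis
    using reweighted_eq_partition_sum[of p "nths ys A"] assms len by simp
qed

text \<open>
  A partition of \<^term>\<open>insert a A\<close> amounts to the other members \<open>S\<close> of the block of \<open>a\<close>
  together with a partition of the rest.
\<close>

lemma sum_partition_on_insert:
  fixes f :: "'b set \<Rightarrow> 'c::comm_semiring_1"
  assumes a: "a \<notin> A" and fin: "finite A"
  shows "(\<Sum>P | partition_on (insert a A) P. \<Prod>D\<in>P. f D) =
    (\<Sum>S\<in>Pow A. f (insert a S) * (\<Sum>P | partition_on (A - S) P. \<Prod>D\<in>P. f D))"
proof -
  have finP: "finite {P. partition_on (A - S) P}" for S
    by (rule finitely_many_partition_on) (use fin in auto)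
  have "(\<Sum>S\<in>Pow A. f (insert a S) * (\<Sum>P | partition_on (A - S) P. \<Prod>D\<in>P. f D)) =
      (\<Sum>(S, P)\<in>Sigma (Pow A) (\<lambda>S. {P. partition_on (A - S) P}). f (insert a S) * (\<Prod>D\<in>P. f D))"
    using finP fin by (simp add: sum_distrib_left sum.Sigma)
  also have "\<dots> = (\<Sum>P | partition_on (insert a A) P. \<Prod>D\<in>P. f D)"
  proof (rule sum.reindex_bij_witness[where
      j = "\<lambda>(S, P). insert (insert a S) P" and
      i = "\<lambda>P. (\<Union>{D\<in>P. a \<in> D} - {a}, {D\<in>P. a \<notin> D})"])
    fix SP assume "SP \<in> Sigma (Pow A) (\<lambda>S. {P. partition_on (A - S) P})"
    then obtain S P where SP: "SP = (S, P)" "S \<subseteq> A" and P: "partition_on (A - S) P" by auto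
    have aP: "a \<notin> D" if "D \<in> P" for D using P that a by (auto simp: partition_on_def)
    have notin: "insert a S \<notin> P" using aP by blast
    have *: "{D \<in> insert (insert a S) P. a \<in> D} = {insert a S}"
      "{D \<in> insert (insert a S) P. a \<notin> D} = P" using aP by auto
    show "(\<Union>{D\<in>(case SP of (S, P) \<Rightarrow> insert (insert a S) P). a \<in> D} - {a},
        {D\<in>(case SP of (S, P) \<Rightarrow> insert (insert a S) P). a \<notin> D}) = SP"
      using SP a unfolding SP(1) prod.case * by auto
    have "partition_on (insert a A) (insert (insert a S) P)"
    proof (subst partition_on_insert)
      show "disjnt (insert a S) (\<Union>P)"
        using P aP by (auto simp: partition_on_def disjnt_def)
      have "insert a A - insert a S = A - S" using a by auto
      then show "partition_on (insert a A - insert a S) P \<and> insert a S \<subseteq> insert a A \<and> insert a S \<noteq> {}"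
        using P SP(2) by auto
    qed
    then show "(case SP of (S, P) \<Rightarrow> insert (insert a S) P) \<in> {P. partition_on (insert a A) P}"
      using SP by simp
    have "finite P" using finite_elements[OF _ P] fin by simp
    then show "(\<Prod>D\<in>(case SP of (S, P) \<Rightarrow> insert (insert a S) P). f D) =
        (case SP of (S, P) \<Rightarrow> f (insert a S) * (\<Prod>D\<in>P. f D))"
      using SP notin by simp
  next
    fix P assume "P \<in> {P. partition_on (insert a A) P}"
    then have P: "partition_on (insert a A) P" by simp
    then obtain E where E: "E \<in> P" "a \<in> E" by (auto simp: partition_on_def)
    have uniq: "D = E" if "D \<in> P" "a \<in> D" for D
      using P E that by (auto simp: partition_on_def disjoint_def)
    have 1: "{D\<in>P. a \<in> D} = {E}" using E uniq by blast
    have 2: "{D\<in>P. a \<notin> D} = P - {E}" using E uniq by blast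
    have "E - {a} \<subseteq> A" using P E by (auto simp: partition_on_def)
    moreover have "partition_on (A - (E - {a})) (P - {E})"
    proof -
      have "disjnt E (\<Union>(P - {E}))"
        using P E by (auto simp: partition_on_def disjoint_def disjnt_def)
      moreover have "insert E (P - {E}) = P" using E by auto
      moreover have "insert a A - E = A - (E - {a})" using a E by auto
      ultimately show ?thesis using partition_on_insert[of E "P - {E}" "insert a A"] P by simp
    qed
    ultimately show "(\<Union>{D\<in>P. a \<in> D} - {a}, {D\<in>P. a \<notin> D}) \<in>
        Sigma (Pow A) (\<lambda>S. {P. partition_on (A - S) P})"
      unfolding 1 2 by auto
    show "(case (\<Union>{D\<in>P. a \<in> D} - {a}, {D\<in>P. a \<notin> D}) of (S, P) \<Rightarrow> insert (insert a S) P) = P"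
      unfolding 1 2 using E by (auto simp: insert_absorb)
  qed
  finally show ?thesis by simp
qed

text \<open>
  The partition sum sorted by the block of the distinguished first point. This is the recursion
  behind the Cauchy product for the \<open>J\<close>-function, with the origin as first point.
\<close>

lemma reweighted_Cons:
  assumes p: "p [] = 1" "\<And>y. p [y] \<noteq> 0"
  shows "reweighted p (y # ys) = (\<Sum>S\<in>Pow {..<length ys}.
    cumulant p (y # nths ys S) * reweighted p (nths ys ({..<length ys} - S)))"
proof -
  let ?n = "length ys"
  let ?F = "\<lambda>A. \<Sum>P | partition_on A P. \<Prod>D\<in>P. cumulant p (nths (y # ys) D)"
  have F: "?F (Suc ` A) = reweighted p (nths ys A)" if "A \<subseteq> {..<?n}" for A
  proof -
    have "nths (y # ys) (Suc ` A) = nths ys A" by (simp add: nths_Cons image_iff)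
    moreover have "?F (Suc ` A) = reweighted p (nths (y # ys) (Suc ` A))"
      by (rule reweighted_nths[OF p, symmetric]) (use that in auto)
    ultimately show ?thesis by simp
  qed
  have "{..<length (y # ys)} = insert 0 (Suc ` {..<?n})"
    by (simp add: lessThan_Suc_eq_insert_0)
  then have "reweighted p (y # ys) = ?F (insert 0 (Suc ` {..<?n}))"
    using reweighted_eq_partition_sum[OF p, where ys = "y # ys"] by simp
  also have "\<dots> = (\<Sum>S\<in>Pow (Suc ` {..<?n}). cumulant p (nths (y # ys) (insert 0 S)) *
      ?F (Suc ` {..<?n} - S))"
    by (rule sum_partition_on_insert) auto
  also have "\<dots> = (\<Sum>S\<in>Pow {..<?n}. cumulant p (nths (y # ys) (insert 0 (Suc ` S))) *
      ?F (Suc ` {..<?n} - Suc ` S))"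
    by (simp add: image_Pow_surj[OF refl, symmetric] sum.reindex inj_on_def inj_image_eq_iff)
  also have "\<dots> = (\<Sum>S\<in>Pow {..<?n}. cumulant p (y # nths ys S) *
      reweighted p (nths ys ({..<?n} - S)))"
  proof (rule sum.cong[OF refl])
    fix S assume "S \<in> Pow {..<?n}"
    have "Suc ` {..<?n} - Suc ` S = Suc ` ({..<?n} - S)" by auto
    moreover have "nths (y # ys) (insert 0 (Suc ` S)) = y # nths ys S"
      by (simp add: nths_Cons image_iff)
    ultimately show "cumulant p (nths (y # ys) (insert 0 (Suc ` S))) *
        ?F (Suc ` {..<?n} - Suc ` S) =
        cumulant p (y # nths ys S) * reweighted p (nths ys ({..<?n} - S))"
      using F[of "{..<?n} - S"] by simp
  qed
  finally show ?thesis .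
qed

lemma shift_simps:
  "shift a [] = []" "shift a ((x, i) # ys) = (x + a, i) # shift a ys" "length (shift a ys) = length ys"
  "nths (shift a ys) D = shift a (nths ys D)"
  by (simp_all add: shift_def nths_map)

text \<open>
  A cumulant is a reweighted function minus products of cumulants of shorter tuples, so invariance
  follows by induction on the length; the next lemma is the converse, read off the partition sum.
\<close>

lemma cumulant_shift_invariant:
  assumes "\<And>ys. reweighted p (shift a ys) = reweighted p ys"
  shows "cumulant p (shift a ys) = cumulant p ys"
proof (induction ys rule: length_induct)
  case (1 ys)
  have "cumulant p (nths (shift a ys) D) = cumulant p (nths ys D)"
    if "partition_on {..<length ys} P" "P \<noteq> {{..<length ys}}" "D \<in> P" for P D
    using 1 length_nths_partition_block[OF that] by (simp add: shift_simps)
  then have "(\<Prod>D\<in>P. cumulant p (nths (shift a ys) D)) = (\<Prod>D\<in>P. cumulant p (nths ys D))"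
    if "partition_on {..<length ys} P" "P \<noteq> {{..<length ys}}" for P
    using that by (intro prod.cong) auto
  then show ?case
    using assms[of ys] unfolding reweighted_def
    by (simp add: cumulant.simps[of p ys] cumulant.simps[of p "shift a ys"] shift_simps)
qed

lemma reweighted_shift_invariant:
  assumes "p [] = 1" "\<And>y. p [y] \<noteq> 0"
    and "\<And>ys. cumulant p (shift a ys) = cumulant p ys"
  shows "reweighted p (shift a ys) = reweighted p ys"
  using assms by (simp add: reweighted_eq_partition_sum shift_simps)

lemma cumulant_pair: "1 + cumulant p [y, z] = p [y, z] / (p [y] * p [z])"
proof -
  have "{P. partition_on {..<2::nat} P \<and> P \<noteq> {{..<2}}} = {{{0}, {1}}}" (is "?L = _")
  proof -
    have "P = {{0}, {1}}" if P: "partition_on {..<2::nat} P" "P \<noteq> {{..<2}}" for P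
    proof -
      have "D = {0} \<or> D = {1}" if "D \<in> P" for D
      proof -
        have "D \<subset> {..<2}" using partition_block_less[OF P that] .
        moreover have "D \<noteq> {}" using P that by (auto simp: partition_on_def)
        moreover have "{..<2::nat} = {0, 1}" by auto
        ultimately show ?thesis by auto
      qed
      moreover have "\<exists>D\<in>P. 0 \<in> D" "\<exists>D\<in>P. 1 \<in> D"
        using P by (auto simp: partition_on_def set_eq_iff)
      ultimately show ?thesis by force
    qed
    moreover have "partition_on {..<2::nat} {{0}, {1}}" "{{0}, {1}} \<noteq> {{..<2::nat}}"
      by (auto simp: partition_on_def disjoint_def)
    ultimately show ?thesis by blast
  qed
  moreover have "length (nths [y, z] {0}) \<le> 1" "length (nths [y, z] {1}) \<le> 1"
    by (simp_all add: nths_Cons)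
  then have "cumulant p (nths [y, z] {0}) = 1" "cumulant p (nths [y, z] {1}) = 1"
    by (simp_all add: cumulant.simps[of p "nths _ _"])
  ultimately show ?thesis
    by (simp add: cumulant.simps[of p "[y, z]"] numeral_2_eq_2)
qed

section \<open>Integrals over disjoint groups of coordinates\<close>

text \<open>
  Distributes two blocks of consecutive coordinates over the positions in \<open>S\<close> and in its
  complement, keeping their order.
\<close>

definition place :: "nat \<Rightarrow> nat set \<Rightarrow> (nat \<Rightarrow> 'a) \<times> (nat \<Rightarrow> 'a) \<Rightarrow> nat \<Rightarrow> 'a" where
  "place k S uv = (\<lambda>i\<in>{..<k}.
     if i \<in> S then fst uv (position S i) else snd uv (position ({..<k} - S) i))"

lemma measurable_place:
  assumes S: "S \<subseteq> {..<k}"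
  shows "place k S \<in> Pi\<^sub>M {..<card S} (\<lambda>_. N) \<Otimes>\<^sub>M Pi\<^sub>M {..<k - card S} (\<lambda>_. N) \<rightarrow>\<^sub>M Pi\<^sub>M {..<k} (\<lambda>_. N)"
proof -
  have fin: "finite S" "finite ({..<k} - S)" using S finite_subset by auto
  have cards: "card ({..<k} - S) = k - card S" using S fin by (simp add: card_Diff_subset)
  show ?thesis
    unfolding place_def
  proof (rule measurable_restrict)
    fix i assume i: "i \<in> {..<k}"
    show "(\<lambda>uv. if i \<in> S then fst uv (position S i) else snd uv (position ({..<k} - S) i))
        \<in> Pi\<^sub>M {..<card S} (\<lambda>_. N) \<Otimes>\<^sub>M Pi\<^sub>M {..<k - card S} (\<lambda>_. N) \<rightarrow>\<^sub>M N"
    proof (cases "i \<in> S")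
      case True
      then show ?thesis
        using position_less[OF fin(1) True]
        by (auto intro!: measurable_compose[OF measurable_fst] measurable_component_singleton)
    next
      case False
      then show ?thesis
        using position_less[OF fin(2), of i] i cards
        by (auto intro!: measurable_compose[OF measurable_snd] measurable_component_singleton)
    qed
  qed
qed

lemma place_vimage:
  assumes S: "S \<subseteq> {..<k}"
    and u: "u \<in> extensional {..<card S}" and v: "v \<in> extensional {..<k - card S}"
  defines "e \<equiv> the_inv_into S (position S)"
  defines "e' \<equiv> the_inv_into ({..<k} - S) (position ({..<k} - S))"
  shows "place k S (u, v) \<in> Pi\<^sub>E {..<k} A \<longleftrightarrow>
    u \<in> Pi\<^sub>E {..<card S} (\<lambda>i. A (e i)) \<and> v \<in> Pi\<^sub>E {..<k - card S} (\<lambda>i. A (e' i))"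
proof -
  have fin: "finite S" "finite ({..<k} - S)" using S finite_subset by auto
  have cards: "card ({..<k} - S) = k - card S" using S fin by (simp add: card_Diff_subset)
  let ?f = "position S" and ?f' = "position ({..<k} - S)"
  have b: "inj_on ?f S" "?f ` S = {..<card S}" "inj_on ?f' ({..<k} - S)" "?f' ` ({..<k} - S) = {..<k - card S}"
    using bij_betw_position[OF fin(1)] bij_betw_position[OF fin(2)] cards by (auto simp: bij_betw_def)
  have e: "e (?f i) = i" if "i \<in> S" for i unfolding e_def by (rule the_inv_into_f_f[OF b(1) that])
  have e': "e' (?f' i) = i" if "i < k" "i \<notin> S" for i
    unfolding e'_def using that by (intro the_inv_into_f_f[OF b(3)]) auto
  have "(\<forall>i\<in>S. u (?f i) \<in> A i) \<longleftrightarrow> (\<forall>n\<in>?f ` S. u n \<in> A (e n))" using e by auto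
  moreover have "(\<forall>i\<in>{..<k} - S. v (?f' i) \<in> A i) \<longleftrightarrow> (\<forall>n\<in>?f' ` ({..<k} - S). v n \<in> A (e' n))"
    using e' by auto
  moreover have "place k S (u, v) \<in> Pi\<^sub>E {..<k} A \<longleftrightarrow>
      (\<forall>i\<in>S. u (?f i) \<in> A i) \<and> (\<forall>i\<in>{..<k} - S. v (?f' i) \<in> A i)"
    using S by (auto simp: place_def PiE_iff)
  ultimately show ?thesis using u v unfolding b by (auto simp: PiE_iff)
qed

text \<open>
  Relabelling coordinates preserves a product of equal factors, so integration over \<open>k\<close> points
  becomes integration over two independent groups of points.
\<close>

lemma distr_place:
  fixes N :: "'a measure"
  assumes S: "S \<subseteq> {..<k}" and N: "sigma_finite_measure N"
  shows "distr (Pi\<^sub>M {..<card S} (\<lambda>_. N) \<Otimes>\<^sub>M Pi\<^sub>M {..<k - card S} (\<lambda>_. N)) (Pi\<^sub>M {..<k} (\<lambda>_. N)) (place k S)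
    = Pi\<^sub>M {..<k} (\<lambda>_. N)"
proof -
  interpret product_sigma_finite "\<lambda>_ :: nat. N"
    using N by (intro product_sigma_finite.intro)
  interpret U: finite_product_sigma_finite "\<lambda>_ :: nat. N" "{..<card S}" by standard simp
  interpret V: finite_product_sigma_finite "\<lambda>_ :: nat. N" "{..<k - card S}" by standard simp
  have fin: "finite S" "finite ({..<k} - S)" using S finite_subset by auto
  have cards: "card ({..<k} - S) = k - card S" using S fin by (simp add: card_Diff_subset)
  define e where "e = the_inv_into S (position S)"
  define e' where "e' = the_inv_into ({..<k} - S) (position ({..<k} - S))"
  have be: "bij_betw e {..<card S} S"
    unfolding e_def by (rule bij_betw_the_inv_into[OF bij_betw_position[OF fin(1)]])
  have be': "bij_betw e' {..<k - card S} ({..<k} - S)"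
    unfolding e'_def cards[symmetric] by (rule bij_betw_the_inv_into[OF bij_betw_position[OF fin(2)]])
  show ?thesis
  proof (rule PiM_eqI)
    fix A :: "nat \<Rightarrow> 'a set" assume A: "\<And>i. i \<in> {..<k} \<Longrightarrow> A i \<in> sets N"
    have Ae: "A (e i) \<in> sets N" if "i < card S" for i
      using A be S that by (auto simp: bij_betw_def)
    have Ae': "A (e' i) \<in> sets N" if "i < k - card S" for i
      using A be' that by (auto simp: bij_betw_def)
    have "place k S -` Pi\<^sub>E {..<k} A \<inter> space (Pi\<^sub>M {..<card S} (\<lambda>_. N) \<Otimes>\<^sub>M Pi\<^sub>M {..<k - card S} (\<lambda>_. N))
        = Pi\<^sub>E {..<card S} (\<lambda>i. A (e i)) \<times> Pi\<^sub>E {..<k - card S} (\<lambda>i. A (e' i))"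
      (is "?L = ?R")
    proof (intro set_eqI)
      fix uv :: "(nat \<Rightarrow> 'a) \<times> (nat \<Rightarrow> 'a)"
      obtain u v where uv: "uv = (u, v)" by (cases uv)
      have R: "uv \<in> ?R \<Longrightarrow> uv \<in> space (Pi\<^sub>M {..<card S} (\<lambda>_. N) \<Otimes>\<^sub>M Pi\<^sub>M {..<k - card S} (\<lambda>_. N))"
        using Ae[THEN sets.sets_into_space] Ae'[THEN sets.sets_into_space]
        by (auto simp: space_pair_measure space_PiM PiE_iff) blast+
      show "uv \<in> ?L \<longleftrightarrow> uv \<in> ?R"
        using place_vimage[OF S, of u v A] R unfolding uv e_def e'_def
        by (auto simp: space_pair_measure space_PiM PiE_iff)
    qed
    moreover have "Pi\<^sub>E {..<k} A \<in> sets (Pi\<^sub>M {..<k} (\<lambda>_. N))"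
      using A by (intro sets_PiM_I_finite) auto
    ultimately have "emeasure (distr (Pi\<^sub>M {..<card S} (\<lambda>_. N) \<Otimes>\<^sub>M Pi\<^sub>M {..<k - card S} (\<lambda>_. N))
          (Pi\<^sub>M {..<k} (\<lambda>_. N)) (place k S)) (Pi\<^sub>E {..<k} A) =
        emeasure (Pi\<^sub>M {..<card S} (\<lambda>_. N) \<Otimes>\<^sub>M Pi\<^sub>M {..<k - card S} (\<lambda>_. N))
          (Pi\<^sub>E {..<card S} (\<lambda>i. A (e i)) \<times> Pi\<^sub>E {..<k - card S} (\<lambda>i. A (e' i)))"
      by (simp add: emeasure_distr[OF measurable_place[OF S]])
    also have "\<dots> = emeasure (Pi\<^sub>M {..<card S} (\<lambda>_. N)) (Pi\<^sub>E {..<card S} (\<lambda>i. A (e i))) *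
        emeasure (Pi\<^sub>M {..<k - card S} (\<lambda>_. N)) (Pi\<^sub>E {..<k - card S} (\<lambda>i. A (e' i)))"
      using Ae Ae' by (intro V.emeasure_pair_measure_Times sets_PiM_I_finite) auto
    also have "\<dots> = (\<Prod>i<card S. emeasure N (A (e i))) * (\<Prod>i<k - card S. emeasure N (A (e' i)))"
      using Ae Ae' emeasure_PiM[of "{..<card S}" "\<lambda>i. A (e i)"]
        emeasure_PiM[of "{..<k - card S}" "\<lambda>i. A (e' i)"] by simp
    also have "\<dots> = (\<Prod>i\<in>S. emeasure N (A i)) * (\<Prod>i\<in>{..<k} - S. emeasure N (A i))"
      using prod.reindex_bij_betw[OF be, of "\<lambda>i. emeasure N (A i)"]
        prod.reindex_bij_betw[OF be', of "\<lambda>i. emeasure N (A i)"] by (simp only:)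
    also have "\<dots> = (\<Prod>i<k. emeasure N (A i))"
      using prod.subset_diff[OF S finite_lessThan, of "\<lambda>i. emeasure N (A i)"] by (simp only: mult.commute)
    finally show "emeasure (distr (Pi\<^sub>M {..<card S} (\<lambda>_. N) \<Otimes>\<^sub>M Pi\<^sub>M {..<k - card S} (\<lambda>_. N))
          (Pi\<^sub>M {..<k} (\<lambda>_. N)) (place k S)) (Pi\<^sub>E {..<k} A) = (\<Prod>i\<in>{..<k}. emeasure N (A i))" .
  qed auto
qed

lemma length_marked [simp]: "length (marked k x I) = k"
  by (simp add: marked_def)

lemma marked_append: "marked (Suc k) x I = marked k x I @ [(x k, I k)]"
  by (simp add: marked_def)

text \<open>
  The points of a subtuple depend on the chosen coordinates only, renumbered by position.
\<close>

lemma nths_marked_position: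
  assumes "T \<subseteq> {..<k}" "\<And>i. i \<in> T \<Longrightarrow> x i = u (position T i)"
  shows "nths (marked k x (\<lambda>_. c)) T = marked (card T) u (\<lambda>_. c)"
  using assms
proof (induction k arbitrary: T)
  case 0
  then show ?case by (simp add: marked_def)
next
  case (Suc k)
  have fin: "finite T" using Suc.prems(1) by (rule finite_subset) simp
  have *: "{j \<in> T. j < k \<and> j < i} = {j \<in> T. j < i}" if "i \<le> k" for i
    using that by auto
  have IH: "nths (marked k x (\<lambda>_. c)) (T \<inter> {..<k}) = marked (card (T \<inter> {..<k})) u (\<lambda>_. c)"
    using Suc.prems by (intro Suc.IH) (auto simp: *)
  have eq: "nths (marked k x (\<lambda>_. c)) T = nths (marked k x (\<lambda>_. c)) (T \<inter> {..<k})"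
    unfolding nths_def by (rule arg_cong[of _ _ "map fst"], rule filter_cong) (auto simp: set_zip)
  show ?case
  proof (cases "k \<in> T")
    case True
    then have T: "T = insert k (T \<inter> {..<k})" using Suc.prems(1) by (auto simp: less_Suc_eq)
    then have "card T = Suc (card (T \<inter> {..<k}))"
      by (metis Int_iff card_insert_disjoint fin finite_Int lessThan_iff less_irrefl)
    moreover have "{j \<in> T. j < k} = T \<inter> {..<k}" by auto
    ultimately show ?thesis
      using IH eq True Suc.prems(2)[OF True] by (simp add: marked_append nths_append)
  next
    case False
    then have "T \<inter> {..<k} = T" using Suc.prems(1) by (auto simp: less_Suc_eq)
    then show ?thesis using IH False by (simp add: marked_append nths_append)
  qed
qed

lemma nths_marked_place:
  assumes S: "S \<subseteq> {..<k}"
  shows "nths (marked k (place k S (u, v)) (\<lambda>_. c)) S = marked (card S) u (\<lambda>_. c)"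
    and "nths (marked k (place k S (u, v)) (\<lambda>_. c)) ({..<k} - S) = marked (k - card S) v (\<lambda>_. c)"
proof -
  have fin: "finite S" using S finite_subset by auto
  show "nths (marked k (place k S (u, v)) (\<lambda>_. c)) S = marked (card S) u (\<lambda>_. c)"
    using S by (intro nths_marked_position) (auto simp: place_def)
  have "nths (marked k (place k S (u, v)) (\<lambda>_. c)) ({..<k} - S) = marked (card ({..<k} - S)) v (\<lambda>_. c)"
    by (intro nths_marked_position) (auto simp: place_def)
  then show "nths (marked k (place k S (u, v)) (\<lambda>_. c)) ({..<k} - S) = marked (k - card S) v (\<lambda>_. c)"
    using S fin by (simp add: card_Diff_subset)
qed

lemma place_mem_PiE_const:
  assumes S: "S \<subseteq> {..<k}"
    and "u \<in> extensional {..<card S}" "v \<in> extensional {..<k - card S}"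
  shows "place k S (u, v) \<in> Pi\<^sub>E {..<k} (\<lambda>_. C) \<longleftrightarrow>
    u \<in> Pi\<^sub>E {..<card S} (\<lambda>_. C) \<and> v \<in> Pi\<^sub>E {..<k - card S} (\<lambda>_. C)"
  using place_vimage[OF assms, of "\<lambda>_. C"] by simp

text \<open>
  A product of a function of the points in \<open>S\<close> and a function of the remaining points integrates to
  a product that depends on \<open>S\<close> only through its cardinality. Measurability of \<open>f\<close> and \<open>g\<close>
  is required on the box over \<open>C\<close> only; it enters through integrability.
\<close>

lemma integral_nths_split:
  fixes f g :: "('a::euclidean_space \<times> component) list \<Rightarrow> real"
  assumes S: "S \<subseteq> {..<k}"
    and f: "set_integrable (lebesgue_power (card S)) (Pi\<^sub>E {..<card S} (\<lambda>_. C)) (\<lambda>x. f (marked (card S) x (\<lambda>_. c)))"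
    and g: "set_integrable (lebesgue_power (k - card S)) (Pi\<^sub>E {..<k - card S} (\<lambda>_. C)) (\<lambda>x. g (marked (k - card S) x (\<lambda>_. c)))"
  shows "set_integrable (lebesgue_power k) (Pi\<^sub>E {..<k} (\<lambda>_. C))
      (\<lambda>x. f (nths (marked k x (\<lambda>_. c)) S) * g (nths (marked k x (\<lambda>_. c)) ({..<k} - S)))" (is ?A)
    and "(LINT x:Pi\<^sub>E {..<k} (\<lambda>_. C)|lebesgue_power k.
        f (nths (marked k x (\<lambda>_. c)) S) * g (nths (marked k x (\<lambda>_. c)) ({..<k} - S))) =
      (LINT x:Pi\<^sub>E {..<card S} (\<lambda>_. C)|lebesgue_power (card S). f (marked (card S) x (\<lambda>_. c))) *
      (LINT x:Pi\<^sub>E {..<k - card S} (\<lambda>_. C)|lebesgue_power (k - card S). g (marked (k - card S) x (\<lambda>_. c)))" (is ?B)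
proof -
  interpret product_sigma_finite "\<lambda>_ :: nat. lborel :: 'a measure" by standard
  interpret U: finite_product_sigma_finite "\<lambda>_ :: nat. lborel :: 'a measure" "{..<card S}" by standard simp
  interpret V: finite_product_sigma_finite "\<lambda>_ :: nat. lborel :: 'a measure" "{..<k - card S}" by standard simp
  interpret UV: pair_sigma_finite "lebesgue_power (card S) :: (nat \<Rightarrow> 'a) measure" "lebesgue_power (k - card S) :: (nat \<Rightarrow> 'a) measure" ..
  define F where "F = (\<lambda>u. indicator (Pi\<^sub>E {..<card S} (\<lambda>_. C)) u * f (marked (card S) u (\<lambda>_. c)))"
  define G where "G = (\<lambda>v. indicator (Pi\<^sub>E {..<k - card S} (\<lambda>_. C)) v * g (marked (k - card S) v (\<lambda>_. c)))"
  let ?H = "\<lambda>x. indicator (Pi\<^sub>E {..<k} (\<lambda>_. C)) x * (f (nths (marked k x (\<lambda>_. c)) S) *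
        g (nths (marked k x (\<lambda>_. c)) ({..<k} - S)))"
  let ?P = "lebesgue_power (card S) \<Otimes>\<^sub>M lebesgue_power (k - card S) :: ((nat \<Rightarrow> 'a) \<times> (nat \<Rightarrow> 'a)) measure"
  have F: "integrable (lebesgue_power (card S)) F" and G: "integrable (lebesgue_power (k - card S)) G"
    using f g by (simp_all add: set_integrable_def F_def G_def)
  have FG: "integrable ?P (\<lambda>w. F (fst w) * G (snd w))"
  proof (rule UV.Fubini_integrable)
    have [measurable]: "F \<in> borel_measurable (lebesgue_power (card S))"
      "G \<in> borel_measurable (lebesgue_power (k - card S))"
      using F G by (auto dest: borel_measurable_integrable)
    show "(\<lambda>w. F (fst w) * G (snd w)) \<in> borel_measurable ?P" by measurable
    show "integrable (lebesgue_power (card S)) (\<lambda>u. LINT v|lebesgue_power (k - card S).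
        norm (F (fst (u, v)) * G (snd (u, v))))"
      using F G by (simp add: norm_mult abs_mult)
    show "AE u in lebesgue_power (card S). integrable (lebesgue_power (k - card S))
        (\<lambda>v. F (fst (u, v)) * G (snd (u, v)))"
      using G by simp
  qed
  have eq: "?H (place k S w) = F (fst w) * G (snd w)" if "w \<in> space ?P" for w
  proof -
    obtain u v where w: "w = (u, v)" by (cases w)
    have "u \<in> extensional {..<card S}" "v \<in> extensional {..<k - card S}"
      using that w by (auto simp: space_pair_measure space_PiM PiE_def)
    then show ?thesis
      using place_mem_PiE_const[OF S, of u v C] nths_marked_place[OF S, of u v c] w
      by (simp add: F_def G_def indicator_def)
  qed
  \<comment> \<open>On the product space \<open>?H\<close> reads two groups of coordinates separately, hence inherits
    measurability from \<open>F\<close> and \<open>G\<close>.\<close>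
  have meas: "?H \<in> borel_measurable (lebesgue_power k)"
  proof -
    have fin: "finite S" "finite ({..<k} - S)" using S finite_subset by auto
    have cards: "card ({..<k} - S) = k - card S" using S fin by (simp add: card_Diff_subset)
    define e where "e = the_inv_into S (position S)"
    define e' where "e' = the_inv_into ({..<k} - S) (position ({..<k} - S))"
    have be: "bij_betw e {..<card S} S"
      unfolding e_def by (rule bij_betw_the_inv_into[OF bij_betw_position[OF fin(1)]])
    have be': "bij_betw e' {..<k - card S} ({..<k} - S)"
      unfolding e'_def cards[symmetric] by (rule bij_betw_the_inv_into[OF bij_betw_position[OF fin(2)]])
    have e: "e (position S i) = i" if "i \<in> S" for i
      unfolding e_def using bij_betw_position[OF fin(1)] that
      by (intro the_inv_into_f_f) (auto simp: bij_betw_def)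
    have e': "e' (position ({..<k} - S) i) = i" if "i \<in> {..<k} - S" for i
      unfolding e'_def using bij_betw_position[OF fin(2)] that
      by (intro the_inv_into_f_f[of _ "{..<k} - S"]) (auto simp: bij_betw_def)
    let ?u = "\<lambda>x :: nat \<Rightarrow> 'a. \<lambda>j\<in>{..<card S}. x (e j)"
    let ?v = "\<lambda>x :: nat \<Rightarrow> 'a. \<lambda>j\<in>{..<k - card S}. x (e' j)"
    have u: "?u \<in> lebesgue_power k \<rightarrow>\<^sub>M lebesgue_power (card S)"
      using be S by (intro measurable_restrict measurable_component_singleton) (auto simp: bij_betw_def)
    have v: "?v \<in> lebesgue_power k \<rightarrow>\<^sub>M lebesgue_power (k - card S)"
      using be' by (intro measurable_restrict measurable_component_singleton) (auto simp: bij_betw_def)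
    have H: "?H x = F (?u x) * G (?v x)" if x: "x \<in> space (lebesgue_power k)" for x
    proof -
      have "place k S (?u x, ?v x) i = x i" for i
        using x e[of i] e'[of i] position_less[OF fin(1), of i] position_less[OF fin(2), of i] cards
        by (auto simp: place_def space_PiM PiE_iff extensional_def)
      then have "place k S (?u x, ?v x) = x" by blast
      moreover have "(?u x, ?v x) \<in> space ?P"
        using measurable_space[OF u x] measurable_space[OF v x] by (simp add: space_pair_measure)
      ultimately show ?thesis using eq[of "(?u x, ?v x)"] by simp
    qed
    have [measurable]: "F \<in> borel_measurable (lebesgue_power (card S))"
      "G \<in> borel_measurable (lebesgue_power (k - card S))"
      using F G by (auto dest: borel_measurable_integrable)
    have "(\<lambda>x. F (?u x) * G (?v x)) \<in> borel_measurable (lebesgue_power k)"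
      using measurable_compose[OF u, of F borel] measurable_compose[OF v, of G borel]
      by (intro borel_measurable_times) auto
    then show ?thesis by (subst measurable_cong[OF H])
  qed
  note P = distr_place[OF S sigma_finite_lborel]
  note mp = measurable_place[OF S, of "lborel :: 'a measure"]
  have "integrable ?P (\<lambda>w. ?H (place k S w)) \<longleftrightarrow> integrable ?P (\<lambda>w. F (fst w) * G (snd w))"
    by (rule Bochner_Integration.integrable_cong[OF refl eq])
  then have "integrable (distr ?P (lebesgue_power k) (place k S)) ?H"
    using FG integrable_distr_eq[OF mp meas] by simp
  then show ?A unfolding P by (simp add: set_integrable_def)
  have "integral\<^sup>L (distr ?P (lebesgue_power k) (place k S)) ?H = (LINT w|?P. ?H (place k S w))"
    by (rule integral_distr[OF mp meas])
  also have "\<dots> = (LINT w|?P. F (fst w) * G (snd w))"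
    by (rule Bochner_Integration.integral_cong[OF refl eq])
  also have "\<dots> = (LINT u|lebesgue_power (card S). LINT v|lebesgue_power (k - card S). F u * G v)"
    using UV.integral_fst'[OF FG] by simp
  also have "\<dots> = integral\<^sup>L (lebesgue_power (card S)) F * integral\<^sup>L (lebesgue_power (k - card S)) G"
    by simp
  finally show ?B unfolding P by (simp add: set_lebesgue_integral_def F_def G_def)
qed

section \<open>Random closed sets and Tonelli's theorem\<close>

lemma prod_list_marked: "(\<Prod>y\<leftarrow>marked k x I. h y) = (\<Prod>j<k. h (x j, I j) :: 'c::comm_monoid_mult)"
  by (induction k) (simp_all add: marked_def lessThan_Suc mult.commute)

lemma space_fell: "space fell = {F. closed F}"
  by (simp add: fell_def space_measure_of_conv)

lemma sets_fell_hitting: "compact K \<Longrightarrow> {F. closed F \<and> F \<inter> K \<noteq> {}} \<in> sets fell"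
  unfolding fell_def by (subst sets_measure_of) (auto intro!: sigma_sets.Basic)

lemma measurable_pair_countable_snd:
  fixes f :: "'x \<Rightarrow> 'i \<Rightarrow> 'y"
  assumes "\<And>i. i \<in> A \<Longrightarrow> (\<lambda>x. f x i) \<in> N \<rightarrow>\<^sub>M L" and "countable A"
  shows "(\<lambda>(x, i). f x i) \<in> N \<Otimes>\<^sub>M count_space A \<rightarrow>\<^sub>M L"
proof -
  have "(\<lambda>z. f (fst z) (snd z)) \<in> N \<Otimes>\<^sub>M count_space A \<rightarrow>\<^sub>M L"
    using assms by (intro measurable_compose_countable'[where I = A and f = "\<lambda>i z. f (fst z) i" and g = snd])
      (auto intro: measurable_compose[OF measurable_fst])
  then show ?thesis by (simp add: case_prod_beta')
qed

text \<open>
  The part of the hypotheses that yields moments of all orders of the model; stationarity is added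
  later.
\<close>

locale random_set_and_field = prob_space M for M :: "'w measure" +
  fixes X :: "component \<Rightarrow> 'w \<Rightarrow> 'a::euclidean_space set"
    and \<Gamma> :: "component \<Rightarrow> 'a \<Rightarrow> 'w \<Rightarrow> real"
  assumes closed_set: "bivariate_random_closed_set M X"
    and field: "bivariate_random_field M \<Gamma>"
    and nonneg: "\<And>i x. AE \<omega> in M. 0 \<le> \<Gamma> i x \<omega>"
    and indep: "independent_set_field M X \<Gamma>"
    and finite_moments: "\<And>ys. integrable M (\<lambda>\<omega>. \<Prod>(x, i)\<leftarrow>ys. \<Gamma> i x \<omega>)"
begin

abbreviation model_coverage :: "('a \<times> component) list \<Rightarrow> real" where
  "model_coverage \<equiv> coverage_model M X \<Gamma>"

text \<open>
  The density of the model. Extended non-negative values let Tonelli's theorem apply without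
  integrability side conditions.
\<close>

definition masked :: "component \<Rightarrow> 'a \<Rightarrow> 'w \<Rightarrow> ennreal" where
  "masked i x \<omega> = ennreal (\<Gamma> i x \<omega>) * indicator (X i \<omega>) x"

lemma closed_X: "\<omega> \<in> space M \<Longrightarrow> closed (X i \<omega>)"
  using measurable_space[OF closed_set[unfolded bivariate_random_closed_set_def], of \<omega>]
  by (auto simp: space_PiM space_fell)

lemma X_measurable: "X i \<in> M \<rightarrow>\<^sub>M fell"
  using measurable_compose[OF closed_set[unfolded bivariate_random_closed_set_def]
      measurable_component_singleton[of i UNIV]] by simp

lemma hitting_event:
  assumes "compact K" shows "{\<omega> \<in> space M. X i \<omega> \<inter> K \<noteq> {}} \<in> sets M"
proof -
  have "X i -` {F. closed F \<and> F \<inter> K \<noteq> {}} \<inter> space M \<in> sets M"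
    by (rule measurable_sets[OF X_measurable sets_fell_hitting[OF assms]])
  moreover have "X i -` {F. closed F \<and> F \<inter> K \<noteq> {}} \<inter> space M = {\<omega> \<in> space M. X i \<omega> \<inter> K \<noteq> {}}"
    using closed_X by auto
  ultimately show ?thesis by simp
qed

text \<open>
  A point outside a closed set lies in a small closed ball with centre in a countable dense set that
  misses the closed set, and missing a compact ball is an event. So the complement is a countable
  union of measurable rectangles.
\<close>

lemma joint_membership: "{z \<in> space (M \<Otimes>\<^sub>M borel). snd z \<in> X i (fst z)} \<in> sets (M \<Otimes>\<^sub>M borel)"
proof -
  obtain D :: "'a set" where D: "countable D" "\<And>U. open U \<Longrightarrow> U \<noteq> {} \<Longrightarrow> \<exists>d\<in>D. d \<in> U"
    using countable_dense_exists by blast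
  define B where "B q n = cball q (inverse (real (Suc n)))" for q :: 'a and n
  define V where "V = (\<Union>q\<in>D. \<Union>n. (space M - {\<omega> \<in> space M. X i \<omega> \<inter> B q n \<noteq> {}}) \<times> B q n)"
  have "V \<in> sets (M \<Otimes>\<^sub>M borel)"
    unfolding V_def using D(1)
    by (intro sets.countable_UN' sets.countable_UN image_subsetI pair_measureI sets.compl_sets hitting_event)
      (auto simp: B_def)
  moreover have "{z \<in> space (M \<Otimes>\<^sub>M borel). snd z \<in> X i (fst z)} = space (M \<Otimes>\<^sub>M borel) - V"
  proof (intro set_eqI iffI)
    fix z assume "z \<in> {z \<in> space (M \<Otimes>\<^sub>M borel). snd z \<in> X i (fst z)}"
    then show "z \<in> space (M \<Otimes>\<^sub>M borel) - V" by (auto simp: V_def)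
  next
    fix z :: "'w \<times> 'a" assume z: "z \<in> space (M \<Otimes>\<^sub>M borel) - V"
    obtain \<omega> x where wx: "z = (\<omega>, x)" by (cases z)
    have \<omega>: "\<omega> \<in> space M" using z wx by (auto simp: space_pair_measure)
    have "x \<in> X i \<omega>"
    proof (rule ccontr)
      assume "x \<notin> X i \<omega>"
      then obtain e where e: "e > 0" "ball x e \<subseteq> - X i \<omega>"
        using closed_X[OF \<omega>, of i] by (metis ComplI open_Compl openE)
      \<comment> \<open>Radius below \<open>e / 2\<close>: a ball of that radius that contains \<open>x\<close> stays in \<open>ball x e\<close>.\<close>
      obtain n where n: "inverse (real (Suc n)) < e / 2"
        using reals_Archimedean[of "e / 2"] e by auto
      obtain q where q: "q \<in> D" "q \<in> ball x (inverse (real (Suc n)))"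
        using D(2)[of "ball x (inverse (real (Suc n)))"] by auto
      have "x \<in> B q n" using q by (simp add: B_def dist_commute less_imp_le)
      moreover have "B q n \<subseteq> ball x e"
      proof
        fix y assume "y \<in> B q n"
        then have "dist x y \<le> dist x q + inverse (real (Suc n))"
          using dist_triangle[of x y q] by (simp add: B_def)
        also have "\<dots> < e" using q n by simp
        finally show "y \<in> ball x e" by simp
      qed
      ultimately have "z \<in> V" using e q wx \<omega> unfolding V_def by blast
      then show False using z by simp
    qed
    then show "z \<in> {z \<in> space (M \<Otimes>\<^sub>M borel). snd z \<in> X i (fst z)}" using z wx by auto
  qed
  ultimately show ?thesis by auto
qed

lemma measurable_masked: "(\<lambda>(\<omega>, x). masked i x \<omega>) \<in> borel_measurable (M \<Otimes>\<^sub>M borel)"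
proof -
  have [measurable]: "(\<lambda>z. \<Gamma> i (snd z) (fst z)) \<in> borel_measurable (M \<Otimes>\<^sub>M borel)"
    using field by (simp add: bivariate_random_field_def case_prod_beta')
  note joint_membership[of i, measurable]
  have "(\<lambda>z. ennreal (\<Gamma> i (snd z) (fst z)) *
      indicator {z \<in> space (M \<Otimes>\<^sub>M borel). snd z \<in> X i (fst z)} z) \<in> borel_measurable (M \<Otimes>\<^sub>M borel)"
    by measurable
  then show ?thesis
    by (rule measurable_cong[THEN iffD1, rotated])
      (auto simp: masked_def indicator_def space_pair_measure)
qed

lemma measurable_masked_compose [measurable (raw)]:
  assumes "f \<in> N \<rightarrow>\<^sub>M M" "g \<in> N \<rightarrow>\<^sub>M borel"
  shows "(\<lambda>z. masked i (g z) (f z)) \<in> borel_measurable N"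
  using measurable_compose[OF measurable_Pair[OF assms] measurable_masked] by simp

lemma measurable_field_compose [measurable (raw)]:
  assumes "f \<in> N \<rightarrow>\<^sub>M M" "g \<in> N \<rightarrow>\<^sub>M borel"
  shows "(\<lambda>z. \<Gamma> i (g z) (f z)) \<in> borel_measurable N"
proof -
  have "(\<lambda>(\<omega>, x). \<Gamma> i x \<omega>) \<in> borel_measurable (M \<Otimes>\<^sub>M borel)"
    using field by (simp add: bivariate_random_field_def)
  from measurable_compose[OF measurable_Pair[OF assms] this] show ?thesis by simp
qed

lemma membership_event [measurable]: "{\<omega> \<in> space M. x \<in> X i \<omega>} \<in> sets M"
  using hitting_event[of "{x}" i] by simp

text \<open>
  A product of integrals over single points is an integral over tuples, and then the order of
  integration is exchanged. The weight \<open>W\<close> will be \<open>1\<close> or the mass at the origin.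
\<close>

lemma nn_integral_masked_power:
  assumes [measurable]: "W \<in> borel_measurable M" "\<And>j. f j \<in> borel_measurable borel"
  shows "(\<integral>\<^sup>+\<omega>. W \<omega> * (\<Prod>j<k. \<integral>\<^sup>+x. f j x * masked (I j) x \<omega> \<partial>lborel) \<partial>M) =
    (\<integral>\<^sup>+x. (\<Prod>j<k. f j (x j)) * (\<integral>\<^sup>+\<omega>. W \<omega> * (\<Prod>j<k. masked (I j) (x j) \<omega>) \<partial>M) \<partial>lebesgue_power k)"
proof -
  interpret product_sigma_finite "\<lambda>_ :: nat. lborel :: 'a measure" by standard
  interpret L: finite_product_sigma_finite "\<lambda>_ :: nat. lborel :: 'a measure" "{..<k}" by standard simp
  interpret P: pair_sigma_finite M "lebesgue_power k :: (nat \<Rightarrow> 'a) measure" ..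
  have "(\<integral>\<^sup>+\<omega>. W \<omega> * (\<Prod>j<k. \<integral>\<^sup>+x. f j x * masked (I j) x \<omega> \<partial>lborel) \<partial>M) =
      (\<integral>\<^sup>+\<omega>. W \<omega> * (\<integral>\<^sup>+x. (\<Prod>j<k. f j (x j) * masked (I j) (x j) \<omega>) \<partial>lebesgue_power k) \<partial>M)"
  proof (rule nn_integral_cong)
    fix \<omega> assume [measurable]: "\<omega> \<in> space M"
    show "W \<omega> * (\<Prod>j<k. \<integral>\<^sup>+x. f j x * masked (I j) x \<omega> \<partial>lborel) =
      W \<omega> * (\<integral>\<^sup>+x. (\<Prod>j<k. f j (x j) * masked (I j) (x j) \<omega>) \<partial>lebesgue_power k)"
      by (subst product_nn_integral_prod) auto
  qed
  also have "\<dots> = (\<integral>\<^sup>+\<omega>. \<integral>\<^sup>+x. W \<omega> * (\<Prod>j<k. f j (x j) * masked (I j) (x j) \<omega>) \<partial>lebesgue_power k \<partial>M)"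
    by (intro nn_integral_cong nn_integral_cmult[symmetric]) measurable
  also have "\<dots> = (\<integral>\<^sup>+x. \<integral>\<^sup>+\<omega>. W \<omega> * (\<Prod>j<k. f j (x j) * masked (I j) (x j) \<omega>) \<partial>M \<partial>lebesgue_power k)"
    by (rule P.Fubini'[symmetric]) measurable
  also have "\<dots> = (\<integral>\<^sup>+x. (\<Prod>j<k. f j (x j)) * (\<integral>\<^sup>+\<omega>. W \<omega> * (\<Prod>j<k. masked (I j) (x j) \<omega>) \<partial>M) \<partial>lebesgue_power k)"
  proof (rule nn_integral_cong)
    fix x :: "nat \<Rightarrow> 'a"
    show "(\<integral>\<^sup>+\<omega>. W \<omega> * (\<Prod>j<k. f j (x j) * masked (I j) (x j) \<omega>) \<partial>M) =
      (\<Prod>j<k. f j (x j)) * (\<integral>\<^sup>+\<omega>. W \<omega> * (\<Prod>j<k. masked (I j) (x j) \<omega>) \<partial>M)"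
      by (subst nn_integral_cmult[symmetric]) (auto simp: prod.distrib ac_simps)
  qed
  finally show ?thesis .
qed

lemma set_events_generated:
  "{\<omega> \<in> space M. \<forall>(x, i)\<in>set ys. x \<in> X i \<omega>} \<in>
    sets (vimage_algebra (space M) (\<lambda>\<omega> i. X i \<omega>) (Pi\<^sub>M UNIV (\<lambda>_. fell)))" (is "_ \<in> sets ?A")
proof -
  have m: "(\<lambda>\<omega> i. X i \<omega>) \<in> ?A \<rightarrow>\<^sub>M Pi\<^sub>M UNIV (\<lambda>_. fell)"
    using measurable_space[OF closed_set[unfolded bivariate_random_closed_set_def]]
    by (intro measurable_vimage_algebra1) auto
  have Xi: "X i \<in> ?A \<rightarrow>\<^sub>M fell" for i
    using measurable_compose[OF m measurable_component_singleton[of i UNIV]] by simp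
  have "{\<omega> \<in> space M. x \<in> X i \<omega>} \<in> sets ?A" for x i
  proof -
    have "X i -` {F. closed F \<and> F \<inter> {x} \<noteq> {}} \<inter> space ?A \<in> sets ?A"
      by (rule measurable_sets[OF Xi sets_fell_hitting]) simp
    moreover have "X i -` {F. closed F \<and> F \<inter> {x} \<noteq> {}} \<inter> space ?A = {\<omega> \<in> space M. x \<in> X i \<omega>}"
      using closed_X by auto
    ultimately show ?thesis by simp
  qed
  then have "{\<omega> \<in> space ?A. \<forall>y\<in>set ys. fst y \<in> X (snd y) \<omega>} \<in> sets ?A"
    by (intro sets.sets_Collect_finite_All) auto
  then show ?thesis by (simp add: case_prod_beta')
qed

lemma field_products_generated:
  "(\<lambda>\<omega>. \<Prod>(x, i)\<leftarrow>ys. \<Gamma> i x \<omega>) \<in> borel_measurable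
    (vimage_algebra (space M) (\<lambda>\<omega> (i, x). \<Gamma> i x \<omega>) (Pi\<^sub>M UNIV (\<lambda>_. borel)))" (is "_ \<in> borel_measurable ?A")
proof -
  have m: "(\<lambda>\<omega> (i, x). \<Gamma> i x \<omega>) \<in> ?A \<rightarrow>\<^sub>M Pi\<^sub>M UNIV (\<lambda>_. borel)"
    by (intro measurable_vimage_algebra1) (auto simp: space_PiM)
  have "\<Gamma> i x \<in> borel_measurable ?A" for i x
    using measurable_compose[OF m measurable_component_singleton[of "(i, x)" UNIV]] by simp
  then show ?thesis by (induction ys) auto
qed

text \<open>
  Independence enters here only: the indicator is measurable for the sigma-algebra of the random set
  (\<open>set_events_generated\<close>), the product for that of the random field
  (\<open>field_products_generated\<close>).
\<close>

lemma coverage_model_eq_expectation: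
  shows "integrable M (\<lambda>\<omega>. indicator {\<omega> \<in> space M. \<forall>(x, i)\<in>set ys. x \<in> X i \<omega>} \<omega> *
      (\<Prod>(x, i)\<leftarrow>ys. \<Gamma> i x \<omega>))"
    and "model_coverage ys = (LINT \<omega>|M. indicator {\<omega> \<in> space M. \<forall>(x, i)\<in>set ys. x \<in> X i \<omega>} \<omega> *
      (\<Prod>(x, i)\<leftarrow>ys. \<Gamma> i x \<omega>))"
proof -
  let ?E = "{\<omega> \<in> space M. \<forall>(x, i)\<in>set ys. x \<in> X i \<omega>}"
  let ?A = "vimage_algebra (space M) (\<lambda>\<omega> i. X i \<omega>) (Pi\<^sub>M UNIV (\<lambda>_. fell))"
  let ?B = "vimage_algebra (space M) (\<lambda>\<omega> (i, x). \<Gamma> i x \<omega>) (Pi\<^sub>M UNIV (\<lambda>_. borel))"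
  have ind: "indep_set (sets ?A) (sets ?B)"
    using indep by (simp add: independent_set_field_def)
  have EA: "?E \<in> sets ?A" by (rule set_events_generated)
  then have E: "?E \<in> sets M" using indep_setD_ev1[OF ind] by auto
  have int_E: "integrable M (indicator ?E :: 'w \<Rightarrow> real)"
    using E by (simp add: emeasure_eq_measure)
  have IA: "(indicator ?E :: 'w \<Rightarrow> real) \<in> borel_measurable ?A" using EA by simp
  have "indep_var borel (indicator ?E :: 'w \<Rightarrow> real) borel (\<lambda>\<omega>. \<Prod>(x, i)\<leftarrow>ys. \<Gamma> i x \<omega>)"
    unfolding indep_var_eq
  proof (intro conjI)
    show "indep_set (sigma_sets (space M) {indicator ?E -` A \<inter> space M |A. A \<in> sets (borel :: real measure)})
     (sigma_sets (space M) {(\<lambda>\<omega>. \<Prod>(x, i)\<leftarrow>ys. \<Gamma> i x \<omega>) -` A \<inter> space M |A. A \<in> sets borel})"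
      unfolding indep_set_def
    proof (rule indep_sets_mono_sets[OF ind[unfolded indep_set_def]])
      fix b :: bool
      have "sigma_sets (space M) {indicator ?E -` A \<inter> space M |A. A \<in> sets (borel :: real measure)} \<subseteq> sets ?A"
      proof -
        have "sigma_sets (space ?A) {indicator ?E -` A \<inter> space M |A. A \<in> sets (borel :: real measure)} \<subseteq> sets ?A"
          by (rule sets.sigma_sets_subset) (use measurable_sets[OF IA] in auto)
        then show ?thesis by simp
      qed
      moreover have "sigma_sets (space M) {(\<lambda>\<omega>. \<Prod>(x, i)\<leftarrow>ys. \<Gamma> i x \<omega>) -` A \<inter> space M |A. A \<in> sets borel} \<subseteq> sets ?B"
      proof -
        have "sigma_sets (space ?B) {(\<lambda>\<omega>. \<Prod>(x, i)\<leftarrow>ys. \<Gamma> i x \<omega>) -` A \<inter> space M |A. A \<in> sets borel} \<subseteq> sets ?B"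
          by (rule sets.sigma_sets_subset) (use measurable_sets[OF field_products_generated] in auto)
        then show ?thesis by simp
      qed
      ultimately show "case_bool (sigma_sets (space M) {indicator ?E -` A \<inter> space M |A. A \<in> sets (borel :: real measure)})
         (sigma_sets (space M) {(\<lambda>\<omega>. \<Prod>(x, i)\<leftarrow>ys. \<Gamma> i x \<omega>) -` A \<inter> space M |A. A \<in> sets borel}) b
        \<subseteq> case_bool (sets ?A) (sets ?B) b"
        by (cases b) auto
    qed
  qed (use E finite_moments[of ys] in \<open>auto dest: borel_measurable_integrable\<close>)
  from indep_var_integrable[OF this int_E finite_moments] indep_var_lebesgue_integral[OF this int_E finite_moments]
  show "integrable M (\<lambda>\<omega>. indicator ?E \<omega> * (\<Prod>(x, i)\<leftarrow>ys. \<Gamma> i x \<omega>))"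
    "model_coverage ys = (LINT \<omega>|M. indicator ?E \<omega> * (\<Prod>(x, i)\<leftarrow>ys. \<Gamma> i x \<omega>))"
    using E by (simp_all add: coverage_model_def coverage_X_def coverage_field_def)
qed

lemma nn_integral_masked_product:
  "(\<integral>\<^sup>+\<omega>. (\<Prod>(x, i)\<leftarrow>ys. masked i x \<omega>) \<partial>M) = ennreal (model_coverage ys)"
  and model_coverage_nonneg: "0 \<le> model_coverage ys"
proof -
  let ?E = "{\<omega> \<in> space M. \<forall>(x, i)\<in>set ys. x \<in> X i \<omega>}"
  let ?f = "\<lambda>\<omega>. indicator ?E \<omega> * (\<Prod>(x, i)\<leftarrow>ys. \<Gamma> i x \<omega>) :: real"
  have "AE \<omega> in M. \<forall>y\<in>set ys. 0 \<le> \<Gamma> (snd y) (fst y) \<omega>"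
    using nonneg by (intro AE_finite_allI) auto
  with AE_space have *: "AE \<omega> in M. 0 \<le> ?f \<omega> \<and> (\<Prod>(x, i)\<leftarrow>ys. masked i x \<omega>) = ennreal (?f \<omega>)"
  proof (eventually_elim, goal_cases)
    case (1 \<omega>)
    have nn: "0 \<le> (\<Prod>(x, i)\<leftarrow>ys. \<Gamma> i x \<omega>)"
      using 1 by (induction ys) auto
    have "(\<Prod>(x, i)\<leftarrow>ys. masked i x \<omega>) =
        (if \<forall>(x, i)\<in>set ys. x \<in> X i \<omega> then ennreal (\<Prod>(x, i)\<leftarrow>ys. \<Gamma> i x \<omega>) else 0)"
      using 1
    proof (induction ys)
      case (Cons y ys)
      have "0 \<le> (\<Prod>(x, i)\<leftarrow>ys. \<Gamma> i x \<omega>)"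
        using Cons.prems by (induction ys) auto
      then show ?case using Cons by (auto simp: masked_def ennreal_mult' indicator_def)
    qed simp
    then show ?case using nn 1 by (auto simp: indicator_def)
  qed
  have "(\<integral>\<^sup>+\<omega>. (\<Prod>(x, i)\<leftarrow>ys. masked i x \<omega>) \<partial>M) = (\<integral>\<^sup>+\<omega>. ennreal (?f \<omega>) \<partial>M)"
    using * by (intro nn_integral_cong_AE) auto
  also have "\<dots> = ennreal (model_coverage ys)"
    using * coverage_model_eq_expectation[of ys] by (subst nn_integral_eq_integral) auto
  finally show "(\<integral>\<^sup>+\<omega>. (\<Prod>(x, i)\<leftarrow>ys. masked i x \<omega>) \<partial>M) = ennreal (model_coverage ys)" .
  show "0 \<le> model_coverage ys"
    unfolding coverage_model_eq_expectation(2) using * by (intro integral_nonneg_AE) auto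
qed

text \<open>
  Measurability is proved through the extended non-negative integral, for tuples whose points are
  arbitrary measurable functions of a parameter; constant functions account for the origin.
\<close>

lemma measurable_model_coverage:
  assumes "\<And>a i. (a, i) \<in> set as \<Longrightarrow> a \<in> N \<rightarrow>\<^sub>M borel"
  shows "(\<lambda>z. model_coverage (map (\<lambda>(a, i). (a z, i)) as)) \<in> borel_measurable N"
proof -
  have m: "(\<lambda>(z, \<omega>). \<Prod>(x, i)\<leftarrow>map (\<lambda>(a, i). (a z, i)) as. masked i x \<omega>) \<in> borel_measurable (N \<Otimes>\<^sub>M M)"
    using assms
  proof (induction as)
    case (Cons b as)
    obtain a i where b: "b = (a, i)" by (cases b)
    have [measurable]: "a \<in> N \<rightarrow>\<^sub>M borel" using Cons b by auto
    have [measurable]: "(\<lambda>(z, \<omega>). \<Prod>(x, i)\<leftarrow>map (\<lambda>(a, i). (a z, i)) as. masked i x \<omega>) \<in> borel_measurable (N \<Otimes>\<^sub>M M)"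
      using Cons by auto
    have "(\<lambda>w. masked i (a (fst w)) (snd w) * (case w of (z, \<omega>) \<Rightarrow> \<Prod>(x, i)\<leftarrow>map (\<lambda>(a, i). (a z, i)) as. masked i x \<omega>)) \<in> borel_measurable (N \<Otimes>\<^sub>M M)"
      by measurable
    then show ?case using b by (simp add: case_prod_beta')
  qed simp
  have "(\<lambda>z. enn2real (\<integral>\<^sup>+\<omega>. (\<Prod>(x, i)\<leftarrow>map (\<lambda>(a, i). (a z, i)) as. masked i x \<omega>) \<partial>M)) \<in> borel_measurable N"
    using borel_measurable_nn_integral[OF m] by simp
  then show ?thesis
    by (simp only: nn_integral_masked_product enn2real_ennreal[OF model_coverage_nonneg])
qed

end

section \<open>Moment measures\<close>

text \<open>
  A box of marked points is the disjoint union, over the finitely many label vectors, of boxes with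
  fixed labels. Moment measures are prescribed on the latter boxes.
\<close>

lemma emeasure_marked_box_eq_sum:
  fixes k :: nat
  assumes N: "sets N = sets (Pi\<^sub>M {..<k} (\<lambda>_. marked_space :: ('a::euclidean_space \<times> component) measure))"
    and A: "\<And>j. j < k \<Longrightarrow> A j \<in> sets (marked_space :: ('a \<times> component) measure)"
  shows "emeasure N (Pi\<^sub>E {..<k} A) =
    (\<Sum>I\<in>Pi\<^sub>E {..<k} (\<lambda>_. UNIV). emeasure N (Pi\<^sub>E {..<k} (\<lambda>j. ((\<lambda>x. (x, I j)) -` A j) \<times> {I j})))"
proof -
  let ?R = "\<lambda>I. Pi\<^sub>E {..<k} (\<lambda>j. ((\<lambda>x. (x, I j)) -` A j) \<times> {I j}) :: (nat \<Rightarrow> 'a \<times> component) set"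
  let ?L = "Pi\<^sub>E {..<k} (\<lambda>_. UNIV) :: (nat \<Rightarrow> component) set"
  have "Pi\<^sub>E {..<k} A = (\<Union>I\<in>?L. ?R I)"
  proof (intro set_eqI iffI)
    fix y assume y: "y \<in> Pi\<^sub>E {..<k} A"
    have "y \<in> ?R (\<lambda>j\<in>{..<k}. snd (y j))"
      using y by (auto simp: PiE_iff mem_Times_iff)
    then show "y \<in> (\<Union>I\<in>?L. ?R I)"
      by (intro UN_I[of "\<lambda>j\<in>{..<k}. snd (y j)"]) auto
  next
    fix y assume "y \<in> (\<Union>I\<in>?L. ?R I)"
    then obtain I where I: "y \<in> ?R I" by blast
    have "y j \<in> A j" if "j < k" for j
      using PiE_mem[OF I, of j] that by (cases "y j") auto
    then show "y \<in> Pi\<^sub>E {..<k} A" using I by (auto simp: PiE_iff)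
  qed
  moreover have "disjoint_family_on ?R ?L"
    unfolding disjoint_family_on_def
  proof (intro ballI impI)
    fix I I' assume I: "I \<in> ?L" "I' \<in> ?L" "I \<noteq> I'"
    then obtain j where "j < k" "I j \<noteq> I' j" using PiE_ext[OF I(1,2)] by auto
    moreover have "snd (y j) = I j" "snd (y j) = I' j" if "y \<in> ?R I" "y \<in> ?R I'" for y
      using that \<open>j < k\<close> by (auto simp: PiE_iff mem_Times_iff)
    ultimately show "?R I \<inter> ?R I' = {}" by force
  qed
  moreover have "?R I \<in> sets N" for I
    unfolding N using sets_Pair2[OF A] by (intro sets_PiM_I_finite pair_measureI) auto
  moreover have "finite ?L" by (intro finite_PiE) auto
  ultimately show ?thesis
    by (simp add: sum_emeasure[symmetric] image_subset_iff)
qed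

lemma is_moment_measure_unique:
  fixes \<Psi> :: "'w \<Rightarrow> ('a::euclidean_space \<times> component) measure"
  assumes N: "is_moment_measure M \<Psi> k N" and N': "is_moment_measure M \<Psi> k N'"
  shows "N = N'"
proof (rule measure_eqI_PiM_finite[where I = "{..<k}" and M = "\<lambda>_. marked_space"])
  show sN: "sets N = sets (Pi\<^sub>M {..<k} (\<lambda>_. marked_space))"
    and sN': "sets N' = sets (Pi\<^sub>M {..<k} (\<lambda>_. marked_space))"
    using N N' by (auto simp: is_moment_measure_def)
  show "emeasure N (Pi\<^sub>E {..<k} A) = emeasure N' (Pi\<^sub>E {..<k} A)"
    if A: "\<And>j. j \<in> {..<k} \<Longrightarrow> A j \<in> sets (marked_space :: ('a \<times> component) measure)" for A
  proof -
    have rect: "emeasure N (Pi\<^sub>E {..<k} (\<lambda>j. ((\<lambda>x. (x, I j)) -` A j) \<times> {I j})) =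
        emeasure N' (Pi\<^sub>E {..<k} (\<lambda>j. ((\<lambda>x. (x, I j)) -` A j) \<times> {I j}))" for I
    proof -
      have "\<forall>j<k. (\<lambda>x. (x, I j)) -` A j \<in> sets borel"
        using sets_Pair2[OF A] by auto
      then show ?thesis using N N' by (simp add: is_moment_measure_def)
    qed
    show ?thesis
      using emeasure_marked_box_eq_sum[OF sN, of A] emeasure_marked_box_eq_sum[OF sN', of A] A rect
      by simp
  qed
  let ?C = "\<lambda>n :: nat. Pi\<^sub>E {..<k} (\<lambda>_. cball 0 (real n) \<times> UNIV) :: (nat \<Rightarrow> 'a \<times> component) set"
  show "range ?C \<subseteq> prod_algebra {..<k} (\<lambda>_. marked_space)"
    by (auto intro!: prod_algebraI_finite pair_measureI)
  show "(\<Union>n. ?C n) = space (Pi\<^sub>M {..<k} (\<lambda>_. marked_space))"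
  proof (intro set_eqI iffI)
    fix y :: "nat \<Rightarrow> 'a \<times> component" assume y: "y \<in> space (Pi\<^sub>M {..<k} (\<lambda>_. marked_space))"
    obtain n where n: "(\<Sum>j<k. norm (fst (y j))) < real n" using reals_Archimedean2 by blast
    have "norm (fst (y j)) \<le> real n" if "j < k" for j
      using member_le_sum[of j "{..<k}" "\<lambda>j. norm (fst (y j))"] that n by simp
    then show "y \<in> (\<Union>n. ?C n)"
      using y by (auto simp: space_PiM PiE_iff mem_Times_iff intro!: exI[of _ n])
  qed (auto simp: space_PiM PiE_iff space_pair_measure)
  show "emeasure N (?C n) \<noteq> \<infinity>" for n
    using N compact_cball[of 0 "real n"] unfolding is_moment_measure_def by (metis less_irrefl)
qed simp

lemma moment_measure_eqI:
  assumes "is_moment_measure M \<Psi> k N" shows "moment_measure M \<Psi> k = N"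
  unfolding moment_measure_def using assms is_moment_measure_unique by (intro the_equality)

text \<open>
  The measure on marked tuples with density \<open>p\<close> is built with points and labels in
  separate factors, because the coverage functions are integrated over points for fixed labels.
\<close>

definition marked_density_measure ::
    "(('a::euclidean_space \<times> component) list \<Rightarrow> real) \<Rightarrow> nat \<Rightarrow> (nat \<Rightarrow> 'a \<times> component) measure" where
  "marked_density_measure p k =
     distr (density (lebesgue_power k \<Otimes>\<^sub>M count_space (Pi\<^sub>E {..<k} (\<lambda>_. UNIV)))
         (\<lambda>(x, I). ennreal (p (marked k x I))))
       (Pi\<^sub>M {..<k} (\<lambda>_. marked_space)) (\<lambda>(x, I). \<lambda>j\<in>{..<k}. (x j, I j))"

lemma marked_restrict: "marked k x (restrict I {..<k}) = marked k x I"
  by (simp add: marked_def)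

lemma nn_integral_marked_density_measure:
  fixes p :: "('a::euclidean_space \<times> component) list \<Rightarrow> real"
  assumes p: "\<And>I. (\<lambda>x. p (marked k x I)) \<in> borel_measurable (lebesgue_power k)"
    and h: "h \<in> borel_measurable (Pi\<^sub>M {..<k} (\<lambda>_. marked_space))"
  shows "(\<integral>\<^sup>+y. h y \<partial>marked_density_measure p k) =
    (\<Sum>I\<in>Pi\<^sub>E {..<k} (\<lambda>_. UNIV). \<integral>\<^sup>+x. ennreal (p (marked k x I)) * h (\<lambda>j\<in>{..<k}. (x j, I j)) \<partial>lebesgue_power k)"
proof -
  let ?I = "Pi\<^sub>E {..<k} (\<lambda>_. UNIV) :: (nat \<Rightarrow> component) set"
  let ?P = "lebesgue_power k \<Otimes>\<^sub>M count_space ?I :: ((nat \<Rightarrow> 'a) \<times> (nat \<Rightarrow> component)) measure"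
  let ?f = "\<lambda>(x, I). \<lambda>j\<in>{..<k}. (x j, I j) :: 'a \<times> component"
  have fin: "finite ?I" by (intro finite_PiE) auto
  interpret C: sigma_finite_measure "count_space ?I"
    by (rule sigma_finite_measure_count_space_finite[OF fin])
  have fI: "(\<lambda>x. ?f (x, I)) \<in> lebesgue_power k \<rightarrow>\<^sub>M Pi\<^sub>M {..<k} (\<lambda>_. marked_space)" for I
    unfolding prod.case
    by (intro measurable_restrict measurable_Pair measurable_component_singleton) auto
  have f: "?f \<in> ?P \<rightarrow>\<^sub>M Pi\<^sub>M {..<k} (\<lambda>_. marked_space)"
    using fI fin by (intro measurable_pair_countable_snd) (auto intro: countable_finite)
  have d: "(\<lambda>(x, I). ennreal (p (marked k x I))) \<in> borel_measurable ?P"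
    using p fin by (intro measurable_pair_countable_snd) (auto intro: countable_finite)
  have hf: "(\<lambda>w. h (?f w)) \<in> borel_measurable ?P" by (rule measurable_compose[OF f h])
  have "(\<integral>\<^sup>+y. h y \<partial>marked_density_measure p k) =
      (\<integral>\<^sup>+w. (case w of (x, I) \<Rightarrow> ennreal (p (marked k x I))) * h (?f w) \<partial>?P)"
    unfolding marked_density_measure_def using f h d hf
    by (simp add: nn_integral_distr nn_integral_density)
  also have "\<dots> = (\<integral>\<^sup>+x. \<integral>\<^sup>+I. ennreal (p (marked k x I)) * h (?f (x, I)) \<partial>count_space ?I \<partial>lebesgue_power k)"
    using C.nn_integral_fst[OF borel_measurable_times_ennreal[OF d hf]] by simp
  also have "\<dots> = (\<integral>\<^sup>+x. (\<Sum>I\<in>?I. ennreal (p (marked k x I)) * h (?f (x, I))) \<partial>lebesgue_power k)"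
    using fin by (simp add: nn_integral_count_space_finite)
  also have "\<dots> = (\<Sum>I\<in>?I. \<integral>\<^sup>+x. ennreal (p (marked k x I)) * h (?f (x, I)) \<partial>lebesgue_power k)"
    using measurable_compose[OF fI h] p by (intro nn_integral_sum) auto
  finally show ?thesis by simp
qed

lemma emeasure_marked_density_measure:
  fixes p :: "('a::euclidean_space \<times> component) list \<Rightarrow> real"
  assumes p: "\<And>I. (\<lambda>x. p (marked k x I)) \<in> borel_measurable (lebesgue_power k)"
    and B: "\<And>j. j < k \<Longrightarrow> B j \<in> sets borel"
  shows "emeasure (marked_density_measure p k) (Pi\<^sub>E {..<k} (\<lambda>j. B j \<times> {I j})) =
    (\<integral>\<^sup>+x\<in>Pi\<^sub>E {..<k} B. ennreal (p (marked k x I)) \<partial>lebesgue_power k)"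
proof -
  let ?I = "Pi\<^sub>E {..<k} (\<lambda>_. UNIV) :: (nat \<Rightarrow> component) set"
  let ?R = "Pi\<^sub>E {..<k} (\<lambda>j. B j \<times> {I j})"
  have fin: "finite ?I" by (intro finite_PiE) auto
  have R: "?R \<in> sets (Pi\<^sub>M {..<k} (\<lambda>_. marked_space))"
    using B by (intro sets_PiM_I_finite pair_measureI) auto
  have "emeasure (marked_density_measure p k) ?R = (\<integral>\<^sup>+y. indicator ?R y \<partial>marked_density_measure p k)"
    using R by (intro nn_integral_indicator[symmetric]) (simp add: marked_density_measure_def)
  also have "\<dots> = (\<Sum>I'\<in>?I. \<integral>\<^sup>+x. ennreal (p (marked k x I')) * indicator ?R (\<lambda>j\<in>{..<k}. (x j, I' j)) \<partial>lebesgue_power k)"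
    using R by (intro nn_integral_marked_density_measure p) simp
  also have "\<dots> = (\<Sum>I'\<in>?I. if I' = restrict I {..<k} then \<integral>\<^sup>+x\<in>Pi\<^sub>E {..<k} B. ennreal (p (marked k x I)) \<partial>lebesgue_power k else 0)"
  proof (rule sum.cong[OF refl])
    fix I' assume I': "I' \<in> ?I"
    have iff: "(\<lambda>j\<in>{..<k}. (x j, I' j)) \<in> ?R \<longleftrightarrow> I' = restrict I {..<k} \<and> x \<in> Pi\<^sub>E {..<k} B"
      if "x \<in> space (lebesgue_power k)" for x
    proof -
      have "(\<forall>j<k. I' j = I j) \<longleftrightarrow> I' = restrict I {..<k}"
        using I' by (auto simp: PiE_iff extensional_def restrict_def fun_eq_iff)
      then show ?thesis using that by (auto simp: PiE_iff space_PiM)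
    qed
    show "(\<integral>\<^sup>+x. ennreal (p (marked k x I')) * indicator ?R (\<lambda>j\<in>{..<k}. (x j, I' j)) \<partial>lebesgue_power k) =
        (if I' = restrict I {..<k} then \<integral>\<^sup>+x\<in>Pi\<^sub>E {..<k} B. ennreal (p (marked k x I)) \<partial>lebesgue_power k else 0)"
    proof (cases "I' = restrict I {..<k}")
      case True
      then show ?thesis using iff
        by (auto intro!: nn_integral_cong simp: indicator_def marked_restrict)
    next
      case False
      have "(\<integral>\<^sup>+x. ennreal (p (marked k x I')) * indicator ?R (\<lambda>j\<in>{..<k}. (x j, I' j)) \<partial>lebesgue_power k) =
          (\<integral>\<^sup>+(x :: nat \<Rightarrow> 'a). 0 \<partial>lebesgue_power k)"
      proof (rule nn_integral_cong)
        fix x :: "nat \<Rightarrow> 'a" assume "x \<in> space (lebesgue_power k)"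
        then show "ennreal (p (marked k x I')) * indicator ?R (\<lambda>j\<in>{..<k}. (x j, I' j)) = 0"
          using iff[of x] False by (simp add: indicator_def)
      qed
      with False show ?thesis by simp
    qed
  qed
  also have "\<dots> = (\<integral>\<^sup>+x\<in>Pi\<^sub>E {..<k} B. ennreal (p (marked k x I)) \<partial>lebesgue_power k)"
    using fin by (subst sum.delta) auto
  finally show ?thesis .
qed

lemma mem_shift_image: "x \<in> (\<lambda>y. y + a) ` S \<longleftrightarrow> x - a \<in> (S :: 'a::euclidean_space set)"
  using imageI[of "x - a" S "\<lambda>y. y + a"] by auto

lemma reweighted_mult: "reweighted (\<lambda>ys. p ys * q ys) ys = reweighted p ys * reweighted q ys"
proof -
  have "(\<Prod>y\<leftarrow>ys. p [y] * q [y]) = (\<Prod>y\<leftarrow>ys. p [y]) * (\<Prod>y\<leftarrow>ys. q [y])"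
    by (induction ys) (simp_all add: ac_simps)
  then show ?thesis by (simp add: reweighted_def)
qed

context random_set_and_field
begin

lemma coverage_field_nonneg: "0 \<le> coverage_field M \<Gamma> ys"
proof -
  have "AE \<omega> in M. \<forall>y\<in>set ys. 0 \<le> \<Gamma> (snd y) (fst y) \<omega>"
    using nonneg by (intro AE_finite_allI) auto
  then have "AE \<omega> in M. 0 \<le> (\<Prod>(x, i)\<leftarrow>ys. \<Gamma> i x \<omega>)"
  proof eventually_elim
    case (elim \<omega>) then show ?case by (induction ys) auto
  qed
  then show ?thesis unfolding coverage_field_def by (rule integral_nonneg_AE)
qed

lemma measurable_model_coverage_marked:
  "(\<lambda>x. model_coverage (marked k x I)) \<in> borel_measurable (lebesgue_power k)"
  "(\<lambda>x. model_coverage ((y, i) # marked k x I)) \<in> borel_measurable (lebesgue_power k)"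
proof -
  have "(\<lambda>x. model_coverage (map (\<lambda>(a, i). (a x, i)) (map (\<lambda>j. (\<lambda>x. x j, I j)) [0..<k])))
      \<in> borel_measurable (lebesgue_power k)"
    by (rule measurable_model_coverage) (auto intro!: measurable_component_singleton)
  then show "(\<lambda>x. model_coverage (marked k x I)) \<in> borel_measurable (lebesgue_power k)"
    by (simp add: marked_def comp_def)
  have "(\<lambda>x. model_coverage (map (\<lambda>(a, i). (a x, i)) ((\<lambda>_. y, i) # map (\<lambda>j. (\<lambda>x. x j, I j)) [0..<k])))
      \<in> borel_measurable (lebesgue_power k)"
    by (rule measurable_model_coverage) (auto intro!: measurable_component_singleton)
  then show "(\<lambda>x. model_coverage ((y, i) # marked k x I)) \<in> borel_measurable (lebesgue_power k)"
    by (simp add: marked_def comp_def)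
qed

lemma measurable_model_coverage_singleton [measurable]:
  "(\<lambda>x. model_coverage [(x, i)]) \<in> borel_measurable borel"
  using measurable_model_coverage[of "[(\<lambda>x. x, i)]" borel] by simp

lemma emeasure_model:
  assumes "\<omega> \<in> space M" "B \<in> sets borel"
  shows "emeasure (random_field_model X \<Gamma> \<omega>) (B \<times> {i}) = (\<integral>\<^sup>+x. indicator B x * masked i x \<omega> \<partial>lborel)"
  using assms closed_X
  by (subst emeasure_random_field_model)
    (auto simp: masked_def ac_simps intro!: nn_integral_cong)

text \<open>
  Identifies \<^const>\<open>coverage_model\<close> as a density of the moment measures.
\<close>

lemma moment_of_model:
  assumes B: "\<And>j. j < k \<Longrightarrow> B j \<in> sets borel"
  shows "(\<integral>\<^sup>+\<omega>. (\<Prod>j<k. emeasure (random_field_model X \<Gamma> \<omega>) (B j \<times> {I j})) \<partial>M) =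
    (\<integral>\<^sup>+x\<in>Pi\<^sub>E {..<k} B. ennreal (model_coverage (marked k x I)) \<partial>lebesgue_power k)"
proof -
  define B' where "B' j = (if j < k then B j else {})" for j
  have [measurable]: "B' j \<in> sets borel" for j using B by (simp add: B'_def)
  have "(\<integral>\<^sup>+\<omega>. (\<Prod>j<k. emeasure (random_field_model X \<Gamma> \<omega>) (B j \<times> {I j})) \<partial>M) =
      (\<integral>\<^sup>+\<omega>. 1 * (\<Prod>j<k. \<integral>\<^sup>+x. indicator (B' j) x * masked (I j) x \<omega> \<partial>lborel) \<partial>M)"
    using B by (intro nn_integral_cong) (simp add: emeasure_model B'_def)
  also have "\<dots> = (\<integral>\<^sup>+x. (\<Prod>j<k. indicator (B' j) (x j)) *
      (\<integral>\<^sup>+\<omega>. 1 * (\<Prod>j<k. masked (I j) (x j) \<omega>) \<partial>M) \<partial>lebesgue_power k)"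
    by (rule nn_integral_masked_power) auto
  also have "\<dots> = (\<integral>\<^sup>+x\<in>Pi\<^sub>E {..<k} B. ennreal (model_coverage (marked k x I)) \<partial>lebesgue_power k)"
  proof (rule nn_integral_cong)
    fix x :: "nat \<Rightarrow> 'a" assume x: "x \<in> space (lebesgue_power k)"
    have "(\<Prod>j<k. indicator (B' j) (x j)) = (indicator (Pi\<^sub>E {..<k} B) x :: ennreal)"
      using x by (auto simp: indicator_def B'_def PiE_iff space_PiM prod_zero_iff)
    moreover have "(\<integral>\<^sup>+\<omega>. (\<Prod>j<k. masked (I j) (x j) \<omega>) \<partial>M) = ennreal (model_coverage (marked k x I))"
      using nn_integral_masked_product[of "marked k x I"] by (simp add: prod_list_marked)
    ultimately show "(\<Prod>j<k. indicator (B' j) (x j)) * (\<integral>\<^sup>+\<omega>. 1 * (\<Prod>j<k. masked (I j) (x j) \<omega>) \<partial>M) =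
      ennreal (model_coverage (marked k x I)) * indicator (Pi\<^sub>E {..<k} B) x"
      by (simp add: mult.commute)
  qed
  finally show ?thesis .
qed

end

section \<open>Moment stationarity and the cross K-function\<close>

locale stationary_field_model = random_set_and_field M X \<Gamma>
  for M :: "'w measure" and X :: "component \<Rightarrow> 'w \<Rightarrow> 'a::euclidean_space set"
    and \<Gamma> :: "component \<Rightarrow> 'a \<Rightarrow> 'w \<Rightarrow> real" +
  assumes field_stationary: "coverage_reweighted_moment_stationary M (field_measure \<Gamma>) (coverage_field M \<Gamma>)"
    and field_cumulant_shift: "\<And>a ys. cumulant (coverage_field M \<Gamma>) (shift a ys) = cumulant (coverage_field M \<Gamma>) ys"
    and set_stationary: "stationary_closed_set M X"
    and volume_fraction_pos: "\<And>i. 0 < \<P>(\<omega> in M. 0 \<in> X i \<omega>)"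
begin

text \<open>
  The tuple is covered exactly if the random set lies in a measurable family of closed sets, so its
  probability is a function of the distribution, which is invariant under translations. The set
  moves against the tuple, whence the sign of the translation.
\<close>

lemma coverage_X_shift: "coverage_X M X (shift a ys) = coverage_X M X ys"
proof -
  let ?F = "Pi\<^sub>M UNIV (\<lambda>_. fell) :: (component \<Rightarrow> 'a set) measure"
  let ?E = "{F \<in> space ?F. \<forall>y\<in>set ys. fst y \<in> F (snd y)}"
  let ?S = "\<lambda>\<omega> i. (\<lambda>x. x + (- a)) ` X i \<omega>"
  have "{F \<in> space ?F. x \<in> F i} \<in> sets ?F" for x i
  proof -
    have "(\<lambda>F. F i) -` {F. closed F \<and> F \<inter> {x} \<noteq> {}} \<inter> space ?F \<in> sets ?F"
      by (intro measurable_sets[of "\<lambda>F. F i" ?F fell] measurable_component_singleton sets_fell_hitting) auto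
    moreover have "(\<lambda>F. F i) -` {F. closed F \<and> F \<inter> {x} \<noteq> {}} \<inter> space ?F = {F \<in> space ?F. x \<in> F i}"
      by (auto simp: space_PiM space_fell)
    ultimately show ?thesis by simp
  qed
  then have E: "?E \<in> sets ?F" by (intro sets.sets_Collect_finite_All) auto
  have comp: "(\<lambda>\<omega>. ?S \<omega> i) \<in> M \<rightarrow>\<^sub>M fell" for i
    unfolding fell_def
  proof (rule measurable_measure_of)
    fix H :: "'a set set" assume "H \<in> {{F. closed F \<and> F \<inter> K \<noteq> {}} |K. compact K}"
    then obtain K where K: "compact K" and H: "H = {F. closed F \<and> F \<inter> K \<noteq> {}}" by blast
    have "compact ((\<lambda>x. x + a) ` K)" using compact_translation[OF K, of a] by (simp add: add.commute)
    moreover have "(\<lambda>\<omega>. ?S \<omega> i) -` H \<inter> space M = {\<omega> \<in> space M. X i \<omega> \<inter> (\<lambda>x. x + a) ` K \<noteq> {}}"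
    proof -
      have "closed (?S \<omega> i)" if "\<omega> \<in> space M" for \<omega>
        using closed_translation[OF closed_X[OF that, of i], of "- a"] by (simp add: add.commute)
      moreover have "?S \<omega> i \<inter> K \<noteq> {} \<longleftrightarrow> X i \<omega> \<inter> (\<lambda>x. x + a) ` K \<noteq> {}" for \<omega>
        unfolding disjoint_iff by (auto simp: mem_shift_image)
      ultimately show ?thesis unfolding H by auto
    qed
    ultimately show "(\<lambda>\<omega>. ?S \<omega> i) -` H \<inter> space M \<in> sets M"
      using hitting_event by simp
  next
    show "(\<lambda>\<omega>. ?S \<omega> i) \<in> space M \<rightarrow> {F. closed F}"
      using closed_translation[OF closed_X, of _ "- a"] by (auto simp: add.commute)
  qed auto
  have S: "?S \<in> M \<rightarrow>\<^sub>M ?F"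
    using measurable_space[OF comp] comp by (intro measurable_PiM_single') (auto simp: PiE_iff)
  note X = closed_set[unfolded bivariate_random_closed_set_def]
  have "coverage_X M X (shift a ys) = measure (distr M ?F ?S) ?E"
    using E S measurable_space[OF S]
    by (subst measure_distr) (auto simp: coverage_X_def shift_def mem_shift_image[of _ "- a", simplified] case_prod_beta' intro!: arg_cong[where f = "measure M"])
  also have "\<dots> = measure (distr M ?F (\<lambda>\<omega> i. X i \<omega>)) ?E"
    using set_stationary unfolding stationary_closed_set_def by metis
  also have "\<dots> = coverage_X M X ys"
    using E X measurable_space[OF X]
    by (subst measure_distr) (auto simp: coverage_X_def case_prod_beta' intro!: arg_cong[where f = "measure M"])
  finally show ?thesis .
qed

lemma coverage_X_eq_volume_fraction: "coverage_X M X [(x, i)] = \<P>(\<omega> in M. 0 \<in> X i \<omega>)"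
  using coverage_X_shift[of x "[(0, i)]"] by (simp add: shift_def coverage_X_def)

lemma coverage_field_lower: "0 < (INF y. coverage_field M \<Gamma> [y])" "(INF y. coverage_field M \<Gamma> [y]) \<le> coverage_field M \<Gamma> [y]"
proof -
  show "0 < (INF y. coverage_field M \<Gamma> [y])"
    using field_stationary by (simp add: coverage_reweighted_moment_stationary_def)
  show "(INF y. coverage_field M \<Gamma> [y]) \<le> coverage_field M \<Gamma> [y]"
    by (rule cINF_lower) (auto intro!: bdd_belowI[of _ 0] coverage_field_nonneg)
qed

lemma coverage_field_pos: "0 < coverage_field M \<Gamma> [y]"
  using coverage_field_lower(1) coverage_field_lower(2)[of y] by linarith

lemma coverage_X_pos: "0 < coverage_X M X [y]"
  using coverage_X_eq_volume_fraction volume_fraction_pos by (cases y) auto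

lemma model_coverage_pos: "0 < model_coverage [y]"
  by (simp add: coverage_model_def coverage_X_pos coverage_field_pos)

lemma coverage_Nil: "coverage_X M X [] = 1" "coverage_field M \<Gamma> [] = 1" "model_coverage [] = 1"
  by (simp_all add: coverage_X_def coverage_field_def coverage_model_def prob_space)

lemma cumulant_model_shift: "cumulant model_coverage (shift a ys) = cumulant model_coverage ys"
proof (rule cumulant_shift_invariant)
  fix ys
  have "reweighted (coverage_X M X) (shift a ys) = reweighted (coverage_X M X) ys"
  proof -
    have "coverage_X M X [(x + a, i)] = coverage_X M X [(x, i)]" for x i
      by (simp only: coverage_X_eq_volume_fraction)
    then have "(\<Prod>y\<leftarrow>shift a ys. coverage_X M X [y]) = (\<Prod>y\<leftarrow>ys. coverage_X M X [y])"
      by (simp add: shift_def comp_def case_prod_beta')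
    then show ?thesis by (simp add: reweighted_def coverage_X_shift)
  qed
  moreover have "reweighted (coverage_field M \<Gamma>) (shift a ys) = reweighted (coverage_field M \<Gamma>) ys"
    using coverage_field_pos
    by (intro reweighted_shift_invariant field_cumulant_shift) (auto simp: coverage_Nil less_imp_neq[symmetric])
  ultimately show "reweighted model_coverage (shift a ys) = reweighted model_coverage ys"
    using reweighted_mult[of "coverage_X M X" "coverage_field M \<Gamma>"]
    by (simp add: coverage_model_def[abs_def])
qed

text \<open>
  Local finiteness is inherited from the field, since covering probabilities are at most one.
\<close>

lemma is_moment_measure_model:
  assumes "1 \<le> k"
  shows "is_moment_measure M (random_field_model X \<Gamma>) k (marked_density_measure model_coverage k)"
  unfolding is_moment_measure_def
proof (intro conjI allI impI)
  show s: "sets (marked_density_measure model_coverage k) = sets (Pi\<^sub>M {..<k} (\<lambda>_. marked_space))"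
    by (simp add: marked_density_measure_def)
  show "emeasure (marked_density_measure model_coverage k) (Pi\<^sub>E {..<k} (\<lambda>j. B j \<times> {I j})) =
      (\<integral>\<^sup>+\<omega>. (\<Prod>j<k. emeasure (random_field_model X \<Gamma> \<omega>) (B j \<times> {I j})) \<partial>M)"
    if "\<forall>j<k. B j \<in> sets borel" for B I
    using that by (simp add: emeasure_marked_density_measure measurable_model_coverage_marked moment_of_model)
  fix K :: "'a set" assume K: "compact K"
  then have [measurable]: "K \<in> sets borel" by (rule borel_compact)
  obtain N where N: "is_moment_measure M (field_measure \<Gamma>) k N"
    and Np: "\<And>I. emeasure N (Pi\<^sub>E {..<k} (\<lambda>j. K \<times> {I j})) =
      (\<integral>\<^sup>+x\<in>Pi\<^sub>E {..<k} (\<lambda>_. K). ennreal (coverage_field M \<Gamma> (marked k x I)) \<partial>lebesgue_power k)"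
  proof -
    have "is_coverage_function M (field_measure \<Gamma>) k (coverage_field M \<Gamma>)"
      using field_stationary assms by (simp add: coverage_reweighted_moment_stationary_def)
    then obtain N where 1: "is_moment_measure M (field_measure \<Gamma>) k N"
      and 2: "\<And>I B. (\<forall>j<k. B j \<in> sets borel) \<Longrightarrow> emeasure N (Pi\<^sub>E {..<k} (\<lambda>j. B j \<times> {I j})) =
        (\<integral>\<^sup>+x\<in>Pi\<^sub>E {..<k} B. ennreal (coverage_field M \<Gamma> (marked k x I)) \<partial>lebesgue_power k)"
      unfolding is_coverage_function_def by blast
    show ?thesis by (rule that[OF 1 2]) simp
  qed
  have sN: "sets N = sets (Pi\<^sub>M {..<k} (\<lambda>_. marked_space))"
    using N by (simp add: is_moment_measure_def)
  have box: "K \<times> (UNIV :: component set) \<in> sets marked_space"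
    by (intro pair_measureI) auto
  let ?L = "Pi\<^sub>E {..<k} (\<lambda>_. UNIV) :: (nat \<Rightarrow> component) set"
  have "emeasure (marked_density_measure model_coverage k) (Pi\<^sub>E {..<k} (\<lambda>_. K \<times> UNIV)) =
      (\<Sum>I\<in>?L. \<integral>\<^sup>+x\<in>Pi\<^sub>E {..<k} (\<lambda>_. K). ennreal (model_coverage (marked k x I)) \<partial>lebesgue_power k)"
    using emeasure_marked_box_eq_sum[OF s, of "\<lambda>_. K \<times> UNIV"] box
    by (simp add: vimage_def emeasure_marked_density_measure measurable_model_coverage_marked)
  also have "\<dots> \<le> (\<Sum>I\<in>?L. \<integral>\<^sup>+x\<in>Pi\<^sub>E {..<k} (\<lambda>_. K). ennreal (coverage_field M \<Gamma> (marked k x I)) \<partial>lebesgue_power k)"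
  proof (intro sum_mono nn_integral_mono mult_right_mono ennreal_leI)
    fix I x
    have "coverage_X M X (marked k x I) \<le> 1" by (simp add: coverage_X_def)
    then show "model_coverage (marked k x I) \<le> coverage_field M \<Gamma> (marked k x I)"
      unfolding coverage_model_def using coverage_field_nonneg by (rule mult_left_le_one_le[rotated 2])
        (simp add: coverage_X_def)
  qed simp
  also have "\<dots> = emeasure N (Pi\<^sub>E {..<k} (\<lambda>_. K \<times> UNIV))"
    using emeasure_marked_box_eq_sum[OF sN, of "\<lambda>_. K \<times> UNIV"] box by (simp add: vimage_def Np)
  also have "\<dots> < \<infinity>"
    using N K by (simp add: is_moment_measure_def)
  finally show "emeasure (marked_density_measure model_coverage k) (Pi\<^sub>E {..<k} (\<lambda>_. K \<times> UNIV)) < \<infinity>" .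
qed

lemma bivariate_random_measure_model: "bivariate_random_measure M (random_field_model X \<Gamma>)"
  unfolding bivariate_random_measure_def
proof (intro conjI ballI allI impI)
  fix \<omega> assume \<omega>: "\<omega> \<in> space M"
  show "sets (random_field_model X \<Gamma> \<omega>) = sets marked_space"
    by (simp add: random_field_model_def)
  fix K :: "'a set" assume K: "compact K"
  have box: "K \<times> (UNIV :: component set) \<in> sets marked_space"
    using borel_compact[OF K] by (intro pair_measureI) auto
  have g: "(\<lambda>(x, i). ennreal (\<Gamma> i x \<omega>)) \<in> borel_measurable marked_space"
    using \<omega> by (intro measurable_pair_countable_snd) auto
  have f: "(\<lambda>(x, i). ennreal (\<Gamma> i x \<omega>) * indicator (X i \<omega>) x) \<in> borel_measurable marked_space"
    using \<omega> borel_closed[OF closed_X[OF \<omega>]] by (intro measurable_pair_countable_snd) auto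
  have "emeasure (random_field_model X \<Gamma> \<omega>) (K \<times> UNIV) \<le> emeasure (field_measure \<Gamma> \<omega>) (K \<times> UNIV)"
    unfolding random_field_model_def field_measure_def emeasure_density[OF f box] emeasure_density[OF g box]
    by (intro nn_integral_mono) (auto simp: indicator_def)
  also have "\<dots> < \<infinity>"
    using field_stationary \<omega> K
    by (simp add: coverage_reweighted_moment_stationary_def bivariate_random_measure_def)
  finally show "emeasure (random_field_model X \<Gamma> \<omega>) (K \<times> UNIV) < \<infinity>" .
next
  fix B :: "'a set" and i assume [measurable]: "B \<in> sets borel"
  have "(\<lambda>\<omega>. \<integral>\<^sup>+x. indicator B x * masked i x \<omega> \<partial>lborel) \<in> borel_measurable M"
    by measurable
  then show "(\<lambda>\<omega>. emeasure (random_field_model X \<Gamma> \<omega>) (B \<times> {i})) \<in> borel_measurable M"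
    by (subst measurable_cong[OF emeasure_model]) auto
qed

theorem model_moment_stationary:
  "coverage_reweighted_moment_stationary M (random_field_model X \<Gamma>) model_coverage"
  unfolding coverage_reweighted_moment_stationary_def
proof (intro conjI allI impI)
  show "bivariate_random_measure M (random_field_model X \<Gamma>)" by (rule bivariate_random_measure_model)
  show "is_coverage_function M (random_field_model X \<Gamma>) k model_coverage" if "1 \<le> k" for k
    unfolding is_coverage_function_def
    by (intro exI[of _ "marked_density_measure model_coverage k"] conjI allI impI
        is_moment_measure_model that model_coverage_nonneg measurable_model_coverage_marked
        emeasure_marked_density_measure) auto
  show "AE x in lebesgue_power k. cumulant model_coverage (shift a (marked k x I)) =
      cumulant model_coverage (marked k x I)" for k a I
    by (simp add: cumulant_model_shift)
  define c where "c = min (\<P>(\<omega> in M. 0 \<in> X One \<omega>)) (\<P>(\<omega> in M. 0 \<in> X Two \<omega>))"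
  have c: "0 < c" "c \<le> \<P>(\<omega> in M. 0 \<in> X i \<omega>)" for i
    using volume_fraction_pos by (auto simp: c_def intro: component.exhaust[of i])
  have "0 < c * (INF y. coverage_field M \<Gamma> [y])"
    using c coverage_field_lower by simp
  also have "\<dots> \<le> (INF y. model_coverage [y])"
  proof (rule cINF_greatest)
    fix y :: "'a \<times> component"
    obtain x i where y: "y = (x, i)" by (cases y)
    show "c * (INF y. coverage_field M \<Gamma> [y]) \<le> model_coverage [y]"
      unfolding coverage_model_def using c coverage_field_lower coverage_X_eq_volume_fraction[of x i] y
      by (intro mult_mono) (auto intro: less_imp_le)
  qed simp
  finally show "0 < (INF y. model_coverage [y])" .
qed

theorem K12_model:
  "K12 model_coverage t = (LINT x:cball 0 t|lborel. (c12_X M X x + 1) * (c12_field M \<Gamma> x + 1))"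
  unfolding K12_def cumulant_pair
  by (simp add: c12_X_def c12_field_def coverage_model_def coverage_X_def coverage_field_def ac_simps)

end

section \<open>The cross J-function\<close>

text \<open>
  For non-negative \<open>Y\<close> and \<open>Z\<close> the absolute values of the terms integrate to the terms of the
  assumed series, so dominated convergence applies to the exponential series.
\<close>

lemma (in prob_space) expectation_exp_series:
  fixes Z Y :: "'a \<Rightarrow> real"
  assumes nn: "\<And>\<omega>. 0 \<le> Z \<omega>" "\<And>\<omega>. 0 \<le> Y \<omega>"
    and int: "\<And>k. integrable M (\<lambda>\<omega>. Z \<omega> * Y \<omega> ^ k)"
    and summ: "summable (\<lambda>k. expectation (\<lambda>\<omega>. Z \<omega> * Y \<omega> ^ k) / fact k)"
  shows "(\<lambda>k. (-1) ^ k / fact k * expectation (\<lambda>\<omega>. Z \<omega> * Y \<omega> ^ k)) sums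
    expectation (\<lambda>\<omega>. Z \<omega> * exp (- Y \<omega>))"
proof -
  define f where "f k \<omega> = (-1) ^ k / fact k * (Z \<omega> * Y \<omega> ^ k)" for k \<omega>
  have sums: "(\<lambda>k. f k \<omega>) sums (Z \<omega> * exp (- Y \<omega>))" for \<omega>
  proof -
    have "(\<lambda>k. Z \<omega> * ((- Y \<omega>) ^ k /\<^sub>R fact k)) sums (Z \<omega> * exp (- Y \<omega>))"
      by (intro sums_mult exp_converges)
    moreover have "Z \<omega> * ((- Y \<omega>) ^ k /\<^sub>R fact k) = f k \<omega>" for k
      by (simp add: f_def power_minus[of "Y \<omega>"] field_simps)
    ultimately show ?thesis by simp
  qed
  have norm_f: "norm (f k \<omega>) = Z \<omega> * Y \<omega> ^ k / fact k" for k \<omega>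
    using nn by (simp add: f_def abs_mult)
  have norm_sums: "summable (\<lambda>k. norm (f k \<omega>))" for \<omega>
  proof -
    have "summable (\<lambda>k. Z \<omega> * (Y \<omega> ^ k /\<^sub>R fact k))"
      by (intro summable_mult summable_exp_generic)
    moreover have "norm (f k \<omega>) = Z \<omega> * (Y \<omega> ^ k /\<^sub>R fact k)" for k
      unfolding norm_f by (simp add: field_simps)
    ultimately show ?thesis by (simp only:)
  qed
  have "(\<lambda>k. expectation (f k)) sums expectation (\<lambda>\<omega>. \<Sum>k. f k \<omega>)"
  proof (rule sums_integral)
    show "integrable M (f k)" for k unfolding f_def using int by simp
    show "summable (\<lambda>k. expectation (\<lambda>\<omega>. norm (f k \<omega>)))"
      unfolding norm_f using summ by simp
  qed (use norm_sums in auto)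
  moreover have "(\<Sum>k. f k \<omega>) = Z \<omega> * exp (- Y \<omega>)" for \<omega>
    using sums by (rule sums_unique[symmetric])
  moreover have "expectation (f k) = (-1) ^ k / fact k * expectation (\<lambda>\<omega>. Z \<omega> * Y \<omega> ^ k)" for k
    unfolding f_def by simp
  ultimately show ?thesis by (simp only:)
qed

lemma integral_uniform_measure:
  fixes f :: "'w \<Rightarrow> real"
  assumes "finite_measure M" and [measurable]: "A \<in> sets M" "f \<in> borel_measurable M" and pos: "measure M A > 0"
  shows "(LINT x|uniform_measure M A. f x) = (LINT x|M. indicator A x * f x) / measure M A"
proof -
  interpret finite_measure M by fact
  have "uniform_measure M A = density M (\<lambda>x. ennreal (indicator A x / measure M A))"
    unfolding uniform_measure_def
    by (rule arg_cong[where f = "density M"])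
      (auto simp: fun_eq_iff emeasure_eq_measure indicator_def divide_ennreal[symmetric] pos)
  then have "(LINT x|uniform_measure M A. f x) = (LINT x|M. (indicator A x / measure M A) *\<^sub>R f x)"
    by (simp add: integral_density)
  also have "\<dots> = (LINT x|M. indicator A x * f x / measure M A)" by simp
  finally show ?thesis by simp
qed

lemma sum_Pow_card:
  fixes f :: "nat \<Rightarrow> real"
  shows "(\<Sum>S\<in>Pow {..<k::nat}. f (card S)) = (\<Sum>j\<le>k. real (k choose j) * f j)"
proof -
  have "(\<Sum>S\<in>Pow {..<k}. f (card S)) = (\<Sum>j\<le>k. \<Sum>S\<in>{S \<in> Pow {..<k}. card S = j}. f (card S))"
    by (rule sum.group[symmetric])
      (auto intro: subset_eq_atLeast0_lessThan_card simp: atLeast0LessThan[symmetric])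
  also have "\<dots> = (\<Sum>j\<le>k. real (k choose j) * f j)"
  proof (rule sum.cong[OF refl])
    fix j
    have "(\<Sum>S\<in>{S \<in> Pow {..<k}. card S = j}. f (card S)) = (\<Sum>S\<in>{S \<in> Pow {..<k}. card S = j}. f j)"
      by (rule sum.cong) auto
    also have "\<dots> = real (card {S. S \<subseteq> {..<k} \<and> card S = j}) * f j"
      by (simp add: Pow_def)
    also have "\<dots> = real (k choose j) * f j"
      by (simp add: n_subsets)
    finally show "(\<Sum>S\<in>{S \<in> Pow {..<k}. card S = j}. f (card S)) = real (k choose j) * f j" .
  qed
  finally show ?thesis .
qed

context stationary_field_model
begin

lemma measurable_singleton_compose [measurable (raw)]:
  "g \<in> N \<rightarrow>\<^sub>M borel \<Longrightarrow> (\<lambda>z. model_coverage [(g z, i)]) \<in> borel_measurable N"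
  using measurable_compose[OF _ measurable_model_coverage_singleton] .

lemma ball_sets [measurable]: "cball (0::'a) t \<in> sets borel"
  by simp

lemma measurable_reweighted_marked:
  "(\<lambda>x. reweighted model_coverage (marked k x I)) \<in> borel_measurable (lebesgue_power k)"
  "(\<lambda>x. reweighted model_coverage ((y, i) # marked k x I)) \<in> borel_measurable (lebesgue_power k)"
proof -
  have "(\<lambda>x. \<Prod>j<k. model_coverage [(x j, I j)]) \<in> borel_measurable (lebesgue_power k)"
    by (intro borel_measurable_prod measurable_compose[OF _ measurable_model_coverage_singleton])
      (auto intro!: measurable_component_singleton)
  then show "(\<lambda>x. reweighted model_coverage (marked k x I)) \<in> borel_measurable (lebesgue_power k)"
    "(\<lambda>x. reweighted model_coverage ((y, i) # marked k x I)) \<in> borel_measurable (lebesgue_power k)"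
    using measurable_model_coverage_marked unfolding reweighted_def
    by (auto simp: prod_list_marked)
qed

lemma reweighted_nonneg: "0 \<le> reweighted model_coverage ys"
  unfolding reweighted_def
  by (intro divide_nonneg_nonneg model_coverage_nonneg prod_list_nonneg) (auto simp: model_coverage_nonneg)

text \<open>
  The integral of \<^const>\<open>u0\<close> with respect to the model: the variable \<open>Y\<close> of the overview.
\<close>

definition ball_mass :: "real \<Rightarrow> 'w \<Rightarrow> ennreal" where
  "ball_mass t \<omega> = (\<integral>\<^sup>+x. ennreal (indicator (cball 0 t) x / model_coverage [(x, Two)]) * masked Two x \<omega> \<partial>lborel)"

lemma measurable_ball_mass [measurable]: "ball_mass t \<in> borel_measurable M"
  unfolding ball_mass_def by measurable

text \<open>
  Used for \<^term>\<open>hs = []\<close>, which gives the moments of the ball mass, and for \<open>hs\<close> consisting of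
  the origin, which gives the moments weighted by the mass at the origin.
\<close>

lemma ball_mass_moment:
  "(\<integral>\<^sup>+\<omega>. (\<Prod>(x, i)\<leftarrow>hs. ennreal (1 / model_coverage [(x, i)]) * masked i x \<omega>) * ball_mass t \<omega> ^ k \<partial>M) =
    (\<integral>\<^sup>+x\<in>Pi\<^sub>E {..<k} (\<lambda>_. cball 0 t). ennreal (reweighted model_coverage (hs @ marked k x (\<lambda>_. Two))) \<partial>lebesgue_power k)"
proof -
  let ?f = "\<lambda>x. ennreal (indicator (cball 0 t) x / model_coverage [(x, Two)])"
  let ?W = "\<lambda>\<omega>. \<Prod>(x, i)\<leftarrow>hs. ennreal (1 / model_coverage [(x, i)]) * masked i x \<omega>"
  have W: "?W \<in> borel_measurable M"
    by (induction hs) auto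
  have W_eq: "?W \<omega> = ennreal (1 / (\<Prod>y\<leftarrow>hs. model_coverage [y])) * (\<Prod>(x, i)\<leftarrow>hs. masked i x \<omega>)" for \<omega>
  proof (induction hs)
    case (Cons y hs)
    have "0 \<le> (\<Prod>y\<leftarrow>hs. model_coverage [y])"
      by (intro prod_list_nonneg) (auto simp: model_coverage_nonneg)
    then have "ennreal (1 / (model_coverage [y] * (\<Prod>y\<leftarrow>hs. model_coverage [y]))) =
        ennreal (1 / model_coverage [y]) * ennreal (1 / (\<Prod>y\<leftarrow>hs. model_coverage [y]))"
      by (subst ennreal_mult[symmetric]) (auto simp: model_coverage_nonneg)
    then show ?case using Cons by (cases y) (simp add: ac_simps)
  qed simp
  have "(\<integral>\<^sup>+\<omega>. ?W \<omega> * ball_mass t \<omega> ^ k \<partial>M) = (\<integral>\<^sup>+\<omega>. ?W \<omega> * (\<Prod>j<k. \<integral>\<^sup>+x. ?f x * masked Two x \<omega> \<partial>lborel) \<partial>M)"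
    by (simp add: ball_mass_def)
  also have "\<dots> = (\<integral>\<^sup>+x. (\<Prod>j<k. ?f (x j)) * (\<integral>\<^sup>+\<omega>. ?W \<omega> * (\<Prod>j<k. masked Two (x j) \<omega>) \<partial>M) \<partial>lebesgue_power k)"
    by (rule nn_integral_masked_power[OF W]) measurable
  also have "\<dots> = (\<integral>\<^sup>+x\<in>Pi\<^sub>E {..<k} (\<lambda>_. cball 0 t). ennreal (reweighted model_coverage (hs @ marked k x (\<lambda>_. Two))) \<partial>lebesgue_power k)"
  proof (rule nn_integral_cong)
    fix x :: "nat \<Rightarrow> 'a" assume x: "x \<in> space (lebesgue_power k)"
    let ?m = "marked k x (\<lambda>_. Two)"
    have nn: "0 \<le> (\<Prod>y\<leftarrow>hs. model_coverage [y])" "0 \<le> (\<Prod>j<k. model_coverage [(x j, Two)])"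
      by (intro prod_list_nonneg prod_nonneg; auto simp: model_coverage_nonneg)+
    have "(\<Prod>j<k. ?f (x j)) = ennreal (\<Prod>j<k. indicator (cball 0 t) (x j) / model_coverage [(x j, Two)])"
      by (intro prod_ennreal) (simp add: model_coverage_nonneg)
    also have "(\<Prod>j<k. indicator (cball 0 t) (x j) / model_coverage [(x j, Two)]) =
        indicator (Pi\<^sub>E {..<k} (\<lambda>_. cball 0 t)) x / (\<Prod>j<k. model_coverage [(x j, Two)])"
      using x by (auto simp: prod_dividef indicator_def PiE_iff space_PiM prod_zero_iff)
    finally have 1: "(\<Prod>j<k. ?f (x j)) = ennreal (indicator (Pi\<^sub>E {..<k} (\<lambda>_. cball 0 t)) x / (\<Prod>j<k. model_coverage [(x j, Two)]))" .
    have "(\<integral>\<^sup>+\<omega>. ?W \<omega> * (\<Prod>j<k. masked Two (x j) \<omega>) \<partial>M) =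
        (\<integral>\<^sup>+\<omega>. ennreal (1 / (\<Prod>y\<leftarrow>hs. model_coverage [y])) * (\<Prod>(x, i)\<leftarrow>hs @ ?m. masked i x \<omega>) \<partial>M)"
      by (simp add: W_eq prod_list_marked mult.assoc)
    also have "\<dots> = ennreal (1 / (\<Prod>y\<leftarrow>hs. model_coverage [y])) * ennreal (model_coverage (hs @ ?m))"
    proof (subst nn_integral_cmult)
      have "(\<lambda>\<omega>. \<Prod>(x, i)\<leftarrow>ys. masked i x \<omega>) \<in> borel_measurable M" for ys
        by (induction ys) auto
      then show "(\<lambda>\<omega>. \<Prod>(x, i)\<leftarrow>hs @ ?m. masked i x \<omega>) \<in> borel_measurable M" .
    qed (simp only: nn_integral_masked_product)
    finally have 2: "(\<integral>\<^sup>+\<omega>. ?W \<omega> * (\<Prod>j<k. masked Two (x j) \<omega>) \<partial>M) =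
        ennreal (1 / (\<Prod>y\<leftarrow>hs. model_coverage [y]) * model_coverage (hs @ ?m))"
      using nn by (subst ennreal_mult) (simp_all add: model_coverage_nonneg)
    show "(\<Prod>j<k. ?f (x j)) * (\<integral>\<^sup>+\<omega>. ?W \<omega> * (\<Prod>j<k. masked Two (x j) \<omega>) \<partial>M) =
      ennreal (reweighted model_coverage (hs @ ?m)) * indicator (Pi\<^sub>E {..<k} (\<lambda>_. cball 0 t)) x"
      unfolding 1 2 using nn model_coverage_nonneg
      by (subst ennreal_mult[symmetric])
        (auto simp: reweighted_def prod_list_marked indicator_def mult.commute)
  qed
  finally show ?thesis .
qed

text \<open>
  The moments \<open>E (Y\<^sup>k)\<close> and \<open>E (Z Y\<^sup>k)\<close> of the overview (see \<open>real_moments\<close>), and the integrals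
  in the series of the \<open>J\<close>-function.
\<close>

definition void_moment :: "real \<Rightarrow> nat \<Rightarrow> real" where
  "void_moment t k = (LINT x:Pi\<^sub>E {..<k} (\<lambda>_. cball 0 t)|lebesgue_power k.
     reweighted model_coverage (marked k x (\<lambda>_. Two)))"

definition palm_moment :: "real \<Rightarrow> nat \<Rightarrow> real" where
  "palm_moment t k = (LINT x:Pi\<^sub>E {..<k} (\<lambda>_. cball 0 t)|lebesgue_power k.
     reweighted model_coverage ((0, One) # marked k x (\<lambda>_. Two)))"

definition J12_moment :: "real \<Rightarrow> nat \<Rightarrow> real" where
  "J12_moment t k = (LINT x:Pi\<^sub>E {..<k} (\<lambda>_. cball 0 t)|lebesgue_power k. J12_integrand model_coverage k x)"

lemma box_sets [measurable]: "Pi\<^sub>E {..<k} (\<lambda>_. cball (0::'a) t) \<in> sets (lebesgue_power k)"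
  by (intro sets_PiM_I_finite) auto

text \<open>
  The zero-dimensional product space is a single point of mass one; integrability over it, and the
  initial terms of all series, come from this.
\<close>

lemma PiE_power_0: "set_integrable (lebesgue_power 0) (Pi\<^sub>E {..<0::nat} (\<lambda>_. C)) (f :: (nat \<Rightarrow> 'b::euclidean_space) \<Rightarrow> real)"
    "(LINT x:Pi\<^sub>E {..<0::nat} (\<lambda>_. C)|lebesgue_power 0. f x) = f (\<lambda>_. undefined)"
proof -
  have PiM0: "lebesgue_power 0 = (count_space {\<lambda>_. undefined} :: (nat \<Rightarrow> 'b) measure)" by (simp add: PiM_empty)
  show "set_integrable (lebesgue_power 0) (Pi\<^sub>E {..<0::nat} (\<lambda>_. C)) f"
    unfolding set_integrable_def PiM0 by (rule integrable_count_space) simp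
  show "(LINT x:Pi\<^sub>E {..<0::nat} (\<lambda>_. C)|lebesgue_power 0. f x) = f (\<lambda>_. undefined)"
    unfolding set_lebesgue_integral_def PiM0 by (subst lebesgue_integral_count_space_finite) auto
qed

lemma moment_0: "void_moment t 0 = 1" "J12_moment t 0 = 1"
  unfolding void_moment_def J12_moment_def PiE_power_0
  by (simp_all add: marked_def reweighted_def coverage_Nil J12_integrand_def cumulant.simps)

text \<open>
  In the expansion with respect to the moment measure only tuples with all labels \<^const>\<open>Two\<close>
  contribute, since \<^const>\<open>u0\<close> vanishes on the first component.
\<close>

lemma void_moment_eq_expansion:
  assumes conv: "moment_expansion_absolutely_convergent M (random_field_model X \<Gamma>) (u0 model_coverage t)"
    and k: "1 \<le> k"
  shows "set_integrable (lebesgue_power k) (Pi\<^sub>E {..<k} (\<lambda>_. cball 0 t))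
      (\<lambda>x. reweighted model_coverage (marked k x (\<lambda>_. Two)))"
    and "moment_expansion_term M (random_field_model X \<Gamma>) (u0 model_coverage t) k =
      (-1) ^ k / fact k * void_moment t k"
proof -
  let ?u = "\<lambda>y. \<Prod>j<k. u0 model_coverage t (y j)"
  let ?N = "marked_density_measure model_coverage k"
  let ?L = "Pi\<^sub>E {..<k} (\<lambda>_. UNIV) :: (nat \<Rightarrow> component) set"
  let ?g = "\<lambda>x. indicator (Pi\<^sub>E {..<k} (\<lambda>_. cball 0 t)) x * reweighted model_coverage (marked k x (\<lambda>_. Two))"
  have N: "moment_measure M (random_field_model X \<Gamma>) k = ?N"
    by (rule moment_measure_eqI[OF is_moment_measure_model[OF k]])
  have int: "integrable ?N ?u"
    using conv[unfolded moment_expansion_absolutely_convergent_def, THEN conjunct1, rule_format, OF k]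
    unfolding N .
  have u_nn: "0 \<le> ?u y" for y
    by (intro prod_nonneg) (auto simp: u0_def model_coverage_nonneg)
  have sN: "sets ?N = sets (Pi\<^sub>M {..<k} (\<lambda>_. marked_space))" by (simp add: marked_density_measure_def)
  have um: "?u \<in> borel_measurable (Pi\<^sub>M {..<k} (\<lambda>_. marked_space))"
    using borel_measurable_integrable[OF int] measurable_cong_sets[OF sN refl] by blast
  have "(\<integral>\<^sup>+y. ennreal (?u y) \<partial>?N) = (\<Sum>I\<in>?L. \<integral>\<^sup>+x. ennreal (model_coverage (marked k x I)) *
      ennreal (?u (\<lambda>j\<in>{..<k}. (x j, I j))) \<partial>lebesgue_power k)"
    using um by (intro nn_integral_marked_density_measure measurable_model_coverage_marked) auto
  also have "\<dots> = (\<Sum>I\<in>?L. if I = (\<lambda>j\<in>{..<k}. Two) then \<integral>\<^sup>+x. ennreal (?g x) \<partial>lebesgue_power k else 0)"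
  proof (rule sum.cong[OF refl])
    fix I assume I: "I \<in> ?L"
    show "(\<integral>\<^sup>+x. ennreal (model_coverage (marked k x I)) * ennreal (?u (\<lambda>j\<in>{..<k}. (x j, I j))) \<partial>lebesgue_power k) =
        (if I = (\<lambda>j\<in>{..<k}. Two) then \<integral>\<^sup>+x. ennreal (?g x) \<partial>lebesgue_power k else 0)"
    proof (cases "I = (\<lambda>j\<in>{..<k}. Two)")
      case True
      have "ennreal (model_coverage (marked k x I)) * ennreal (?u (\<lambda>j\<in>{..<k}. (x j, I j))) = ennreal (?g x)"
        if x: "x \<in> space (lebesgue_power k)" for x
      proof -
        have "?u (\<lambda>j\<in>{..<k}. (x j, I j)) = (\<Prod>j<k. indicator (cball 0 t) (x j) / model_coverage [(x j, Two)])"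
          by (intro prod.cong) (auto simp: True u0_def indicator_def)
        also have "\<dots> = indicator (Pi\<^sub>E {..<k} (\<lambda>_. cball 0 t)) x / (\<Prod>j<k. model_coverage [(x j, Two)])"
          using x by (auto simp: prod_dividef indicator_def PiE_iff space_PiM prod_zero_iff)
        finally show ?thesis
          using marked_restrict[of k x "\<lambda>_. Two"] True
          by (subst ennreal_mult[symmetric])
            (auto simp: model_coverage_nonneg u_nn reweighted_def prod_list_marked mult.commute
              intro!: divide_nonneg_nonneg prod_nonneg)
      qed
      with True show ?thesis by (auto intro!: nn_integral_cong)
    next
      case False
      then obtain j where j: "j < k" "I j \<noteq> Two"
        using I by (auto simp: PiE_iff extensional_def fun_eq_iff split: if_splits)
      have zero: "?u (\<lambda>j\<in>{..<k}. (x j, I j)) = 0" for x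
        using j by (intro prod_zero) (auto simp: u0_def indicator_def intro!: bexI[of _ j])
      show ?thesis unfolding zero using False by simp
    qed
  qed
  also have "\<dots> = (\<integral>\<^sup>+x. ennreal (?g x) \<partial>lebesgue_power k)"
    by (subst sum.delta) (auto intro: finite_PiE)
  finally have nn: "(\<integral>\<^sup>+y. ennreal (?u y) \<partial>?N) = (\<integral>\<^sup>+x. ennreal (?g x) \<partial>lebesgue_power k)" .
  have gm: "?g \<in> borel_measurable (lebesgue_power k)"
    using measurable_reweighted_marked by (intro borel_measurable_times) auto
  have g_nn: "0 \<le> ?g x" for x by (simp add: reweighted_nonneg)
  have "(\<integral>\<^sup>+y. ennreal (?u y) \<partial>?N) < \<infinity>"
    using int u_nn by (simp add: integrable_iff_bounded)
  then have "integrable (lebesgue_power k) ?g"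
    using gm g_nn nn by (intro integrableI_nonneg) auto
  then show "set_integrable (lebesgue_power k) (Pi\<^sub>E {..<k} (\<lambda>_. cball 0 t))
      (\<lambda>x. reweighted model_coverage (marked k x (\<lambda>_. Two)))"
    by (simp add: set_integrable_def)
  have "(LINT y|?N. ?u y) = enn2real (\<integral>\<^sup>+y. ennreal (?u y) \<partial>?N)"
    using int u_nn by (intro integral_eq_nn_integral) auto
  also have "\<dots> = (LINT x|lebesgue_power k. ?g x)"
    unfolding nn using gm g_nn by (intro integral_eq_nn_integral[symmetric]) auto
  finally show "moment_expansion_term M (random_field_model X \<Gamma>) (u0 model_coverage t) k =
      (-1) ^ k / fact k * void_moment t k"
    by (simp add: moment_expansion_term_def N void_moment_def set_lebesgue_integral_def)
qed

text \<open>
  Integrating \<open>reweighted_Cons\<close> over the ball: the summand of a set \<open>S\<close> of companions of the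
  origin depends on its cardinality only, and there are \<open>k choose j\<close> sets with \<open>j\<close> elements.
\<close>

lemma palm_moment_convolution:
  assumes conv: "moment_expansion_absolutely_convergent M (random_field_model X \<Gamma>) (u0 model_coverage t)"
    and J: "J12_absolutely_convergent model_coverage t"
  shows "set_integrable (lebesgue_power k) (Pi\<^sub>E {..<k} (\<lambda>_. cball 0 t))
      (\<lambda>x. reweighted model_coverage ((0, One) # marked k x (\<lambda>_. Two)))"
    and "palm_moment t k = (\<Sum>j\<le>k. real (k choose j) * (J12_moment t j * void_moment t (k - j)))"
proof -
  let ?B = "Pi\<^sub>E {..<k} (\<lambda>_. cball 0 t) :: (nat \<Rightarrow> 'a) set"
  let ?f = "\<lambda>ys. cumulant model_coverage ((0, One) # ys)"
  let ?g = "reweighted model_coverage"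
  let ?m = "\<lambda>x. marked k x (\<lambda>_. Two)"
  have f: "set_integrable (lebesgue_power n) (Pi\<^sub>E {..<n} (\<lambda>_. cball 0 t)) (\<lambda>x. ?f (marked n x (\<lambda>_. Two)))" for n
    using J PiE_power_0(1) unfolding J12_absolutely_convergent_def J12_integrand_def[abs_def]
    by (cases n) auto
  have g: "set_integrable (lebesgue_power n) (Pi\<^sub>E {..<n} (\<lambda>_. cball 0 t)) (\<lambda>x. ?g (marked n x (\<lambda>_. Two)))" for n
    using void_moment_eq_expansion(1)[OF conv] PiE_power_0(1) by (cases n) auto
  have split: "set_integrable (lebesgue_power k) ?B (\<lambda>x. ?f (nths (?m x) S) * ?g (nths (?m x) ({..<k} - S)))"
    "(LINT x:?B|lebesgue_power k. ?f (nths (?m x) S) * ?g (nths (?m x) ({..<k} - S))) =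
      J12_moment t (card S) * void_moment t (k - card S)" if "S \<in> Pow {..<k}" for S
    using integral_nths_split[of S k "cball 0 t" ?f Two ?g] that f g
    by (auto simp: J12_moment_def void_moment_def J12_integrand_def)
  have rec: "?g ((0, One) # ?m x) = (\<Sum>S\<in>Pow {..<k}. ?f (nths (?m x) S) * ?g (nths (?m x) ({..<k} - S)))" for x
    using reweighted_Cons[of model_coverage "(0, One)" "?m x"] model_coverage_pos
    by (simp add: coverage_Nil less_imp_neq[symmetric])
  show "set_integrable (lebesgue_power k) ?B (\<lambda>x. ?g ((0, One) # ?m x))"
    unfolding rec using split(1) unfolding set_integrable_def scaleR_sum_right
    by (intro Bochner_Integration.integrable_sum) auto
  have "palm_moment t k = (\<Sum>S\<in>Pow {..<k}. LINT x:?B|lebesgue_power k. ?f (nths (?m x) S) * ?g (nths (?m x) ({..<k} - S)))"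
    unfolding palm_moment_def rec using split(1)
    unfolding set_integrable_def set_lebesgue_integral_def scaleR_sum_right
    by (intro Bochner_Integration.integral_sum) auto
  also have "\<dots> = (\<Sum>S\<in>Pow {..<k}. J12_moment t (card S) * void_moment t (k - card S))"
    using split(2) by (intro sum.cong) auto
  also have "\<dots> = (\<Sum>j\<le>k. real (k choose j) * (J12_moment t j * void_moment t (k - j)))"
    by (rule sum_Pow_card)
  finally show "palm_moment t k = (\<Sum>j\<le>k. real (k choose j) * (J12_moment t j * void_moment t (k - j)))" .
qed

lemma measurable_field_mean: "(\<lambda>x. LINT \<omega>|M. \<Gamma> i x \<omega>) \<in> borel_measurable borel"
  by measurable

lemma measurable_void_factor [measurable]: "void_factor M X \<Gamma> t \<in> borel_measurable M"
proof -
  note joint_membership[of Two, measurable]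
  note measurable_field_mean [measurable]
  have "(\<lambda>z. (indicator (cball 0 t) (snd z) * indicator {z \<in> space (M \<Otimes>\<^sub>M borel). snd z \<in> X Two (fst z)} z) *\<^sub>R
      (\<Gamma> Two (snd z) (fst z) / (LINT \<omega>'|M. \<Gamma> Two (snd z) \<omega>'))) \<in> borel_measurable (M \<Otimes>\<^sub>M lborel)"
    by measurable
  then have "(\<lambda>(\<omega>, x). indicator (cball 0 t \<inter> X Two \<omega>) x *\<^sub>R
      (\<Gamma> Two x \<omega> / (LINT \<omega>'|M. \<Gamma> Two x \<omega>'))) \<in> borel_measurable (M \<Otimes>\<^sub>M lborel)"
    by (rule measurable_cong[THEN iffD1, rotated]) (auto simp: space_pair_measure indicator_def)
  from lborel.borel_measurable_lebesgue_integral[OF this]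
  have [measurable]: "(\<lambda>\<omega>. LINT x:cball 0 t \<inter> X Two \<omega>|lborel. \<Gamma> Two x \<omega> / (LINT \<omega>'|M. \<Gamma> Two x \<omega>')) \<in> borel_measurable M"
    by (simp add: set_lebesgue_integral_def)
  show ?thesis unfolding void_factor_def[abs_def] by measurable
qed

lemma AE_field_nonneg: "AE \<omega> in M. AE x in lborel. 0 \<le> \<Gamma> i x \<omega>"
proof -
  interpret P: pair_sigma_finite M "lborel :: 'a measure" ..
  have "AE x in lborel. AE \<omega> in M. 0 \<le> \<Gamma> i x \<omega>" using nonneg by simp
  moreover have "{z \<in> space (M \<Otimes>\<^sub>M lborel). 0 \<le> \<Gamma> i (snd z) (fst z)} \<in> sets (M \<Otimes>\<^sub>M lborel)"
    by measurable
  ultimately show ?thesis by (subst P.AE_commute) auto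
qed

lemma model_coverage_singleton:
  "model_coverage [(x, i)] = \<P>(\<omega> in M. 0 \<in> X i \<omega>) * (LINT \<omega>|M. \<Gamma> i x \<omega>)"
  by (simp add: coverage_model_def coverage_X_eq_volume_fraction) (simp add: coverage_field_def)

lemma field_mean_pos: "0 < (LINT \<omega>|M. \<Gamma> i x \<omega>)"
  using coverage_field_pos[of "(x, i)"] by (simp add: coverage_field_def)

text \<open>
  The void factor is defined by a Bochner integral of \<open>\<Gamma>\<close>, the ball mass by an extended
  non-negative one of its positive part. They agree for almost all \<open>\<omega>\<close>, because almost every path
  is non-negative almost everywhere (\<open>AE_field_nonneg\<close>).
\<close>

lemma void_factor_eq_exp_ball_mass: "AE \<omega> in M. void_factor M X \<Gamma> t \<omega> = exp (- enn2real (ball_mass t \<omega>))"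
  using AE_field_nonneg[of Two] AE_space
proof eventually_elim
  case (elim \<omega>)
  note elim(2) [measurable]
  note measurable_field_mean [measurable]
  have [measurable]: "X Two \<omega> \<in> sets borel" using closed_X[OF elim(2)] by (rule borel_closed)
  let ?P = "\<P>(\<omega> in M. 0 \<in> X Two \<omega>)"
  let ?h = "\<lambda>x. 1 / ?P * (indicator (cball 0 t \<inter> X Two \<omega>) x * (\<Gamma> Two x \<omega> / (LINT \<omega>'|M. \<Gamma> Two x \<omega>')))"
  have "1 / ?P * (LINT x:cball 0 t \<inter> X Two \<omega>|lborel. \<Gamma> Two x \<omega> / (LINT \<omega>'|M. \<Gamma> Two x \<omega>')) = (LINT x|lborel. ?h x)"
    by (simp only: set_lebesgue_integral_def integral_mult_right_zero real_scaleR_def)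
  also have "\<dots> = enn2real (\<integral>\<^sup>+x. ennreal (?h x) \<partial>lborel)"
  proof (rule integral_eq_nn_integral)
    show "?h \<in> borel_measurable lborel" by measurable
    show "AE x in lborel. 0 \<le> ?h x"
      using elim(1) by eventually_elim (auto intro!: mult_nonneg_nonneg divide_nonneg_nonneg less_imp_le[OF field_mean_pos])
  qed
  also have "(\<integral>\<^sup>+x. ennreal (?h x) \<partial>lborel) = ball_mass t \<omega>"
    unfolding ball_mass_def
  proof (intro nn_integral_cong_AE)
    show "AE x in lborel. ennreal (?h x) =
        ennreal (indicator (cball 0 t) x / model_coverage [(x, Two)]) * masked Two x \<omega>"
      using elim(1)
    proof eventually_elim
      case (elim x)
      have "ennreal (1 / model_coverage [(x, Two)]) * ennreal (\<Gamma> Two x \<omega>) = ennreal (1 / model_coverage [(x, Two)] * \<Gamma> Two x \<omega>)"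
        using elim by (subst ennreal_mult[symmetric]) (auto simp: model_coverage_nonneg)
      then show ?case by (auto simp: masked_def indicator_def model_coverage_singleton)
    qed
  qed
  finally show ?case by (simp add: void_factor_def)
qed

text \<open>The variable \<open>Z\<close> of the overview.\<close>

definition origin_mass :: "'w \<Rightarrow> ennreal" where
  "origin_mass \<omega> = ennreal (1 / model_coverage [(0, One)]) * masked One 0 \<omega>"

lemma measurable_origin_mass [measurable]: "origin_mass \<in> borel_measurable M"
  unfolding origin_mass_def by measurable

lemma real_moments:
  assumes conv: "moment_expansion_absolutely_convergent M (random_field_model X \<Gamma>) (u0 model_coverage t)"
  shows "integrable M (\<lambda>\<omega>. enn2real (ball_mass t \<omega>) ^ k)"
    and "expectation (\<lambda>\<omega>. enn2real (ball_mass t \<omega>) ^ k) = void_moment t k"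
    and "J12_absolutely_convergent model_coverage t \<Longrightarrow>
      integrable M (\<lambda>\<omega>. enn2real (origin_mass \<omega>) * enn2real (ball_mass t \<omega>) ^ k)"
    and "J12_absolutely_convergent model_coverage t \<Longrightarrow>
      expectation (\<lambda>\<omega>. enn2real (origin_mass \<omega>) * enn2real (ball_mass t \<omega>) ^ k) = palm_moment t k"
proof -
  let ?B = "\<lambda>k. Pi\<^sub>E {..<k} (\<lambda>_. cball 0 t) :: (nat \<Rightarrow> 'a) set"
  have box: "(\<integral>\<^sup>+x\<in>?B n. ennreal (f x) \<partial>lebesgue_power n) = ennreal (LINT x:?B n|lebesgue_power n. f x)"
    if "set_integrable (lebesgue_power n) (?B n) f" "\<And>x. 0 \<le> f x" for f n
  proof -
    have "(\<integral>\<^sup>+x\<in>?B n. ennreal (f x) \<partial>lebesgue_power n) = (\<integral>\<^sup>+x. ennreal (indicator (?B n) x * f x) \<partial>lebesgue_power n)"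
      by (intro nn_integral_cong) (simp add: indicator_def)
    also have "\<dots> = ennreal (LINT x|lebesgue_power n. indicator (?B n) x * f x)"
      using that by (intro nn_integral_eq_integral) (auto simp: set_integrable_def)
    finally show ?thesis by (simp add: set_lebesgue_integral_def)
  qed
  have void_int: "set_integrable (lebesgue_power n) (?B n) (\<lambda>x. reweighted model_coverage (marked n x (\<lambda>_. Two)))" for n
    using void_moment_eq_expansion(1)[OF conv] PiE_power_0(1) by (cases n) auto
  have Y: "(\<integral>\<^sup>+\<omega>. ball_mass t \<omega> ^ n \<partial>M) = ennreal (void_moment t n)" for n
    using ball_mass_moment[of "[]" t n] box[OF void_int reweighted_nonneg] by (simp add: void_moment_def)
  have void_nn: "0 \<le> void_moment t k" and palm_nn: "0 \<le> palm_moment t k"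
    unfolding void_moment_def palm_moment_def set_lebesgue_integral_def
    by (intro integral_nonneg_AE AE_I2; simp add: reweighted_nonneg)+
  have fin: "AE \<omega> in M. ball_mass t \<omega> \<noteq> \<infinity>"
    using Y[of 1] by (intro nn_integral_PInf_AE) auto
  have "(\<integral>\<^sup>+\<omega>. ennreal (enn2real (ball_mass t \<omega>) ^ k) \<partial>M) = ennreal (void_moment t k)"
    unfolding Y[symmetric] using fin
    by (intro nn_integral_cong_AE) (auto simp: ennreal_power[symmetric] less_top)
  then show "integrable M (\<lambda>\<omega>. enn2real (ball_mass t \<omega>) ^ k)"
    "expectation (\<lambda>\<omega>. enn2real (ball_mass t \<omega>) ^ k) = void_moment t k"
    using void_nn nn_integral_eq_integrable[of "\<lambda>\<omega>. enn2real (ball_mass t \<omega>) ^ k" M "void_moment t k"]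
    by auto
  assume J: "J12_absolutely_convergent model_coverage t"
  have "(\<integral>\<^sup>+\<omega>. origin_mass \<omega> * ball_mass t \<omega> ^ k \<partial>M) = ennreal (palm_moment t k)"
    using ball_mass_moment[of "[(0, One)]" t k] box[OF palm_moment_convolution(1)[OF conv J] reweighted_nonneg]
    by (simp add: palm_moment_def origin_mass_def)
  moreover have "(\<integral>\<^sup>+\<omega>. ennreal (enn2real (origin_mass \<omega>) * enn2real (ball_mass t \<omega>) ^ k) \<partial>M) =
      (\<integral>\<^sup>+\<omega>. origin_mass \<omega> * ball_mass t \<omega> ^ k \<partial>M)"
  proof (intro nn_integral_cong_AE)
    have "origin_mass \<omega> < \<infinity>" for \<omega>
      by (auto simp: origin_mass_def masked_def indicator_def ennreal_mult_less_top)
    then show "AE \<omega> in M. ennreal (enn2real (origin_mass \<omega>) * enn2real (ball_mass t \<omega>) ^ k) =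
        origin_mass \<omega> * ball_mass t \<omega> ^ k"
      using fin by (auto simp: ennreal_mult ennreal_power[symmetric] less_top)
  qed
  ultimately show "integrable M (\<lambda>\<omega>. enn2real (origin_mass \<omega>) * enn2real (ball_mass t \<omega>) ^ k)"
    "expectation (\<lambda>\<omega>. enn2real (origin_mass \<omega>) * enn2real (ball_mass t \<omega>) ^ k) = palm_moment t k"
    using palm_nn nn_integral_eq_integrable[of "\<lambda>\<omega>. enn2real (origin_mass \<omega>) * enn2real (ball_mass t \<omega>) ^ k" M "palm_moment t k"]
    by auto
qed

theorem J12_model:
  assumes conv: "moment_expansion_absolutely_convergent M (random_field_model X \<Gamma>) (u0 model_coverage t)"
    and J: "J12_absolutely_convergent model_coverage t"
  shows "J12 model_coverage t =
    (LINT \<omega>|uniform_measure M {\<omega> \<in> space M. 0 \<in> X One \<omega>}. \<Gamma> One 0 \<omega> * void_factor M X \<Gamma> t \<omega>) /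
    ((LINT \<omega>|M. \<Gamma> One 0 \<omega>) * (LINT \<omega>|M. void_factor M X \<Gamma> t \<omega>))"
proof -
  define a where "a k = (-1) ^ k / fact k * J12_moment t k" for k
  define m where "m k = (-1) ^ k / fact k * void_moment t k" for k
  define Y where "Y \<omega> = enn2real (ball_mass t \<omega>)" for \<omega>
  define Z where "Z \<omega> = enn2real (origin_mass \<omega>)" for \<omega>
  have [measurable]: "Y \<in> borel_measurable M" "Z \<in> borel_measurable M"
    unfolding Y_def Z_def by measurable
  have YZ: "0 \<le> Y \<omega>" "0 \<le> Z \<omega>" for \<omega> by (simp_all add: Y_def Z_def)
  note mom = real_moments[OF conv, folded Y_def Z_def]
  have J12_term: "J12_term model_coverage t k = a k" for k
    by (simp add: J12_term_def a_def J12_moment_def)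
  have summ_a: "summable (\<lambda>k. norm (a k))"
    using J by (subst summable_Suc_iff[symmetric]) (simp add: J12_absolutely_convergent_def J12_term)
  have summ_m: "summable (\<lambda>k. norm (m k))"
  proof (subst summable_Suc_iff[symmetric])
    have "moment_expansion_term M (random_field_model X \<Gamma>) (u0 model_coverage t) (Suc k) = m (Suc k)" for k
      by (simp add: void_moment_eq_expansion(2)[OF conv] m_def)
    then show "summable (\<lambda>k. norm (m (Suc k)))"
      using conv by (simp add: moment_expansion_absolutely_convergent_def)
  qed
  have J12_eq: "J12 model_coverage t = (\<Sum>k. a k)"
    using suminf_split_head[OF summable_norm_cancel[OF summ_a]]
    by (simp add: J12_def J12_term a_def moment_0)
  \<comment> \<open>The binomial convolution of moments is the Cauchy product of the exponential series.\<close>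
  have cauchy: "(\<Sum>i\<le>k. a i * m (k - i)) = (-1) ^ k / fact k * palm_moment t k" for k
  proof -
    have "a i * m (k - i) = (-1) ^ k / fact k * (real (k choose i) * (J12_moment t i * void_moment t (k - i)))"
      if "i \<le> k" for i
    proof -
      have "(-1 :: real) ^ i * (-1) ^ (k - i) = (-1) ^ k"
        using that by (simp add: power_add[symmetric])
      then have "a i * m (k - i) = (-1) ^ k * (J12_moment t i * void_moment t (k - i)) / (fact i * fact (k - i))"
        by (simp add: a_def m_def)
      also have "\<dots> = (-1) ^ k / fact k * (real (k choose i) * (J12_moment t i * void_moment t (k - i)))"
        using that by (simp add: binomial_fact)
      finally show ?thesis .
    qed
    then show ?thesis
      unfolding palm_moment_convolution(2)[OF conv J] sum_distrib_left by (intro sum.cong) auto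
  qed
  have "(\<lambda>k. (-1) ^ k / fact k * void_moment t k) sums expectation (\<lambda>\<omega>. exp (- Y \<omega>))"
  proof -
    have "summable (\<lambda>k. void_moment t k / fact k)"
    proof -
      have "void_moment t k = \<bar>void_moment t k\<bar>" for k
        using YZ integral_nonneg_AE[of "\<lambda>\<omega>. Y \<omega> ^ k" M] by (simp flip: mom(2))
      then show ?thesis using summ_m by (simp add: m_def abs_mult)
    qed
    then show ?thesis
      using expectation_exp_series[of "\<lambda>_. 1" Y] YZ mom by simp
  qed
  then have L: "(\<Sum>k. m k) = expectation (\<lambda>\<omega>. exp (- Y \<omega>))"
    by (simp add: m_def sums_iff)
  have "(\<lambda>k. (-1) ^ k / fact k * palm_moment t k) sums expectation (\<lambda>\<omega>. Z \<omega> * exp (- Y \<omega>))"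
  proof -
    have "summable (\<lambda>k. palm_moment t k / fact k)"
    \<comment> \<open>The moments are non-negative, but the \<open>a i\<close> may have any sign: the bound is the Cauchy
      product of the series of absolute values.\<close>
    proof (rule summable_comparison_test')
      show "summable (\<lambda>k. \<Sum>i\<le>k. norm (a i) * norm (m (k - i)))"
        using summ_a summ_m by (intro summable_Cauchy_product) auto
      show "norm (palm_moment t k / fact k) \<le> (\<Sum>i\<le>k. norm (a i) * norm (m (k - i)))" if "k \<ge> 0" for k
      proof -
        have "norm (palm_moment t k / fact k) = norm (\<Sum>i\<le>k. a i * m (k - i))"
          unfolding cauchy by (simp add: abs_mult)
        also have "\<dots> \<le> (\<Sum>i\<le>k. norm (a i) * norm (m (k - i)))"
          by (rule order_trans[OF norm_sum]) (simp add: abs_mult)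
        finally show ?thesis .
      qed
    qed
    then show ?thesis
      using expectation_exp_series[of Z Y] YZ mom(3,4)[OF J] by simp
  qed
  then have "expectation (\<lambda>\<omega>. Z \<omega> * exp (- Y \<omega>)) = (\<Sum>k. \<Sum>i\<le>k. a i * m (k - i))"
    by (simp add: cauchy sums_iff)
  also have "\<dots> = (\<Sum>k. a k) * (\<Sum>k. m k)"
    by (rule Cauchy_product[OF summ_a summ_m, symmetric])
  finally have key: "expectation (\<lambda>\<omega>. Z \<omega> * exp (- Y \<omega>)) = J12 model_coverage t * expectation (\<lambda>\<omega>. exp (- Y \<omega>))"
    by (simp add: J12_eq L)
  have void: "AE \<omega> in M. void_factor M X \<Gamma> t \<omega> = exp (- Y \<omega>)"
    using void_factor_eq_exp_ball_mass by (simp add: Y_def)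
  have E_void: "(LINT \<omega>|M. void_factor M X \<Gamma> t \<omega>) = expectation (\<lambda>\<omega>. exp (- Y \<omega>))"
    using void by (intro integral_cong_AE) auto
  let ?E = "{\<omega> \<in> space M. 0 \<in> X One \<omega>}"
  let ?P = "prob ?E" and ?G = "LINT \<omega>|M. \<Gamma> One 0 \<omega>"
  have P: "0 < ?P" and G: "0 < ?G" using volume_fraction_pos field_mean_pos by auto
  \<comment> \<open>Conditioning on \<open>0 \<in> X One\<close> and dividing by the mean of the field at the origin produces
    the normalisation of \<open>Z\<close>.\<close>
  have "(LINT \<omega>|M. indicator ?E \<omega> * (\<Gamma> One 0 \<omega> * void_factor M X \<Gamma> t \<omega>)) =
      (LINT \<omega>|M. ?P * ?G * (Z \<omega> * exp (- Y \<omega>)))"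
  proof (rule integral_cong_AE)
    show "AE \<omega> in M. indicator ?E \<omega> * (\<Gamma> One 0 \<omega> * void_factor M X \<Gamma> t \<omega>) = ?P * ?G * (Z \<omega> * exp (- Y \<omega>))"
      using void nonneg[of One 0] AE_space
    proof eventually_elim
      case (elim \<omega>)
      have "Z \<omega> = indicator ?E \<omega> * \<Gamma> One 0 \<omega> / (?P * ?G)"
        using elim P G
        by (auto simp: Z_def origin_mass_def masked_def indicator_def enn2real_mult model_coverage_singleton)
      then show ?case using elim P G by simp
    qed
  qed measurable
  then have "(LINT \<omega>|uniform_measure M ?E. \<Gamma> One 0 \<omega> * void_factor M X \<Gamma> t \<omega>) =
      ?G * expectation (\<lambda>\<omega>. Z \<omega> * exp (- Y \<omega>))"
    using P by (subst integral_uniform_measure) (auto simp: finite_measure_axioms)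
  moreover have "expectation (\<lambda>\<omega>. exp (- Y \<omega>)) \<noteq> 0"
  proof
    assume "expectation (\<lambda>\<omega>. exp (- Y \<omega>)) = 0"
    moreover have "integrable M (\<lambda>\<omega>. exp (- Y \<omega>))"
      using YZ by (intro integrable_const_bound[of _ 1]) auto
    ultimately have "AE \<omega> in M. exp (- Y \<omega>) = 0"
      by (subst (asm) integral_nonneg_eq_0_iff_AE) auto
    then show False by simp
  qed
  ultimately show ?thesis using G by (simp add: E_void key)
qed

end

theorem theorem8:
  fixes M :: "'w measure"
    and X :: "component \<Rightarrow> 'w \<Rightarrow> 'a::euclidean_space set"
    and \<Gamma> :: "component \<Rightarrow> 'a \<Rightarrow> 'w \<Rightarrow> real"
  assumes "prob_space M"
    and "bivariate_random_closed_set M X"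
    and "bivariate_random_field M \<Gamma>"
    and nonneg: "\<And>i x. AE \<omega> in M. 0 \<le> \<Gamma> i x \<omega>"
    and "independent_set_field M X \<Gamma>"
    and "has_continuous_version M \<Gamma>"
    and finite_moments: "\<And>ys. integrable M (\<lambda>\<omega>. \<Prod>(x, i)\<leftarrow>ys. \<Gamma> i x \<omega>)"
    and "coverage_reweighted_moment_stationary M (field_measure \<Gamma>) (coverage_field M \<Gamma>)"
    and pointwise_invariance:
      "\<And>a ys. cumulant (coverage_field M \<Gamma>) (shift a ys) = cumulant (coverage_field M \<Gamma>) ys"
    and "stationary_closed_set M X"
    and "\<And>i. 0 < \<P>(\<omega> in M. 0 \<in> X i \<omega>)"
  shows "coverage_reweighted_moment_stationary M (random_field_model X \<Gamma>) (coverage_model M X \<Gamma>)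
    \<and> (\<forall>t\<ge>0. K12 (coverage_model M X \<Gamma>) t =
          (LINT x:cball 0 t|lborel. (c12_X M X x + 1) * (c12_field M \<Gamma> x + 1)))
    \<and> (\<forall>t\<ge>0.
          moment_expansion_absolutely_convergent M (random_field_model X \<Gamma>)
            (u0 (coverage_model M X \<Gamma>) t) \<and>
          J12_absolutely_convergent (coverage_model M X \<Gamma>) t \<longrightarrow>
          J12 (coverage_model M X \<Gamma>) t =
            (LINT \<omega>|uniform_measure M {\<omega> \<in> space M. 0 \<in> X One \<omega>}.
               \<Gamma> One 0 \<omega> * void_factor M X \<Gamma> t \<omega>) /
            ((LINT \<omega>|M. \<Gamma> One 0 \<omega>) * (LINT \<omega>|M. void_factor M X \<Gamma> t \<omega>)))"
proof -
  interpret stationary_field_model M X \<Gamma>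
    using assms
    by (intro stationary_field_model.intro stationary_field_model_axioms.intro
        random_set_and_field.intro random_set_and_field_axioms.intro)
  show ?thesis
    using model_moment_stationary K12_model J12_model by blast
qed

end
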